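(* For $0\le i\le D$ define $$\mathcal N_i=(E^*_0V+E^*_1V+\cdots+E^*_iV)\cap(E_0V+E_1V+\cdots+E_{D-i}V).$$ Then $\sum_{i=0}^D\mathcal N_i$ is equal to the nucleus of $\Gamma$ with respect to $x$.
   Context: Let $\Gamma$ be a finite, undirected, connected graph without loops or multiple edges, with vertex set $X$, path-length distance $\partial$, and diameter $D\ge 1$. Assume $\Gamma$ is distance-regular: for $0\le h,i,j\le D$ and $y,z\in X$ with $\partial(y,z)=h$, the number of $w\in X$ with $\partial(y,w)=i$, $\partial(z,w)=j$ depends only on $h,i,j$. Let $A\in\mathrm{Mat}_X(\mathbb C)$ be the adjacency matrix. Let $V=\mathbb C^X$. Let $E_0,\dots,E_D$ be an ordering of the primitive idempotents of $A$ (projections onto its eigenspaces) with $E_0=|X|^{-1}J$. Define Krein parameters $q^h_{i,j}$ by $E_i\circ E_j=|X|^{-1}\sum_{h}q^h_{i,j}E_h$ ($\circ$ = entrywise product). Assume $\Gamma$ is $Q$-polynomial with respect to $E_0,\dots,E_D$: $q^h_{i,j}=0$ whenever one of $h,i,j$ exceeds the sum of the other two, and $q^h_{i,j}\neq 0$ whenever one of them equals the sum of the other two. Fix $x\in X$. For $0\le i\le D$ let $E^*_i$ be the diagonal matrix with $(y,y)$-entry $1$ if $\partial(x,y)=i$ and $0$ otherwise. Let $A^*$ be the diagonal matrix with $(y,y)$-entry $|X|(E_1)_{x,y}$. Let $T$ be the subalgebra of $\mathrm{Mat}_X(\mathbb C)$ generated by $A$ and $A^*$. A $T$-module is a subspace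 of $V$ invariant under $T$; it is irreducible if it is nonzero and contains no $T$-modules other than $0$ and itself. For an irreducible $T$-module $W$: its endpoint is $r=\min\{i: E^*_iW\ne 0\}$, its dual endpoint is $t=\min\{i:E_iW\neq0\}$, its diameter is $d=|\{i:E^*_iW\ne0\}|-1$, and its displacement is $r+t-D+d$. The nucleus of $\Gamma$ with respect to $x$ is the span of all irreducible $T$-modules of displacement $0$. *)

theory Defs
  imports "HOL-Analysis.Analysis"
begin

text \<open>
  The vertex set of a graph is the universe of a finite type \<open>'v\<close>; the graph is given by its
  adjacency relation. The space \<open>V\<close> is \<open>complex^'v\<close>. Subspaces and spans are complex ones, hence
  the prefix \<open>vec\<close> (scalar multiplication \<open>*s\<close>); the unprefixed \<open>subspace\<close> and \<open>span\<close> would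
  be the real ones. Sums of subspaces are sums of sets.
\<close>

section \<open>Distance-regular graphs\<close>

definition simple_graph :: "('v \<Rightarrow> 'v \<Rightarrow> bool) \<Rightarrow> bool" where
  "simple_graph adj \<longleftrightarrow> symp adj \<and> irreflp adj"

definition connected_graph :: "('v \<Rightarrow> 'v \<Rightarrow> bool) \<Rightarrow> bool" where
  "connected_graph adj \<longleftrightarrow> (\<forall>y z. adj\<^sup>*\<^sup>* y z)"

definition graph_dist :: "('v \<Rightarrow> 'v \<Rightarrow> bool) \<Rightarrow> 'v \<Rightarrow> 'v \<Rightarrow> nat" where
  "graph_dist adj y z = (LEAST n. (adj ^^ n) y z)"

definition graph_diameter :: "('v::finite \<Rightarrow> 'v \<Rightarrow> bool) \<Rightarrow> nat" where
  "graph_diameter adj = Max {graph_dist adj y z | y z. True}"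

definition distance_regular :: "('v::finite \<Rightarrow> 'v \<Rightarrow> bool) \<Rightarrow> bool" where
  "distance_regular adj \<longleftrightarrow>
     simple_graph adj \<and> connected_graph adj \<and>
     (\<forall>h i j. h \<le> graph_diameter adj \<longrightarrow> i \<le> graph_diameter adj \<longrightarrow> j \<le> graph_diameter adj \<longrightarrow>
        (\<exists>p. \<forall>y z. graph_dist adj y z = h \<longrightarrow>
           card {w. graph_dist adj y w = i \<and> graph_dist adj z w = j} = p))"

definition adjacency_matrix :: "('v::finite \<Rightarrow> 'v \<Rightarrow> bool) \<Rightarrow> complex^'v^'v" where
  "adjacency_matrix adj = (\<chi> y z. if adj y z then 1 else 0)"

section \<open>Primitive idempotents and the Q-polynomial property\<close>

definition matrix_scale :: "complex \<Rightarrow> complex^'n^'m \<Rightarrow> complex^'n^'m" where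
  "matrix_scale c M = (\<chi> y z. c * M $ y $ z)"

definition eigenspace :: "complex^'n^'n \<Rightarrow> complex \<Rightarrow> (complex^'n) set" where
  "eigenspace A \<theta> = {v. A *v v = \<theta> *s v}"

text \<open>The projection onto a nonzero eigenspace along the other eigenspaces. It is unique when
  the matrix is diagonalizable, as is the case for an adjacency matrix.\<close>

definition primitive_idempotent :: "complex^'n^'n \<Rightarrow> complex^'n^'n \<Rightarrow> bool" where
  "primitive_idempotent A F \<longleftrightarrow>
     (\<exists>\<theta>. eigenspace A \<theta> \<noteq> {0} \<and> range ((*v) F) = eigenspace A \<theta> \<and>
        (\<forall>v\<in>eigenspace A \<theta>. F *v v = v) \<and>
        (\<forall>\<mu>. \<mu> \<noteq> \<theta> \<longrightarrow> (\<forall>v\<in>eigenspace A \<mu>. F *v v = 0)))"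

definition idempotent_ordering ::
    "('v::finite \<Rightarrow> 'v \<Rightarrow> bool) \<Rightarrow> (nat \<Rightarrow> complex^'v^'v) \<Rightarrow> bool" where
  "idempotent_ordering adj E \<longleftrightarrow>
     bij_betw E {..graph_diameter adj} {F. primitive_idempotent (adjacency_matrix adj) F} \<and>
     E 0 = matrix_scale (1 / of_nat CARD('v)) (\<chi> y z. 1)"

definition hadamard :: "complex^'n^'m \<Rightarrow> complex^'n^'m \<Rightarrow> complex^'n^'m" where
  "hadamard M N = (\<chi> y z. M $ y $ z * N $ y $ z)"

text \<open>\<open>krein D E h i j\<close> is $q^h_{i,j}$. The coefficients with index \<open>h \<le> D\<close> are unique because
  the primitive idempotents are linearly independent; the others are irrelevant.\<close>

definition krein :: "nat \<Rightarrow> (nat \<Rightarrow> complex^'v^'v) \<Rightarrow> nat \<Rightarrow> nat \<Rightarrow> nat \<Rightarrow> complex" where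
  "krein D E h i j =
     (SOME q. hadamard (E i) (E j) = matrix_scale (1 / of_nat CARD('v)) (\<Sum>l\<le>D. matrix_scale (q l) (E l))) h"

definition Q_polynomial :: "nat \<Rightarrow> (nat \<Rightarrow> complex^'v^'v) \<Rightarrow> bool" where
  "Q_polynomial D E \<longleftrightarrow>
     (\<forall>h i j. h \<le> D \<longrightarrow> i \<le> D \<longrightarrow> j \<le> D \<longrightarrow>
        (h > i + j \<or> i > h + j \<or> j > h + i \<longrightarrow> krein D E h i j = 0) \<and>
        (h = i + j \<or> i = h + j \<or> j = h + i \<longrightarrow> krein D E h i j \<noteq> 0))"

section \<open>The subconstituent algebra and its modules\<close>

definition dual_idempotent :: "('v::finite \<Rightarrow> 'v \<Rightarrow> bool) \<Rightarrow> 'v \<Rightarrow> nat \<Rightarrow> complex^'v^'v" where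
  "dual_idempotent adj x i = (\<chi> y z. if y = z \<and> graph_dist adj x y = i then 1 else 0)"

definition dual_adjacency_matrix :: "(nat \<Rightarrow> complex^'v^'v) \<Rightarrow> 'v::finite \<Rightarrow> complex^'v^'v" where
  "dual_adjacency_matrix E x =
     (\<chi> y z. if y = z then of_nat CARD('v) * E 1 $ x $ y else 0)"

definition matrix_subalgebra :: "(complex^'n^'n) set \<Rightarrow> bool" where
  "matrix_subalgebra S \<longleftrightarrow>
     mat 1 \<in> S \<and> (\<forall>M\<in>S. \<forall>N\<in>S. M + N \<in> S \<and> M ** N \<in> S) \<and> (\<forall>c. \<forall>M\<in>S. matrix_scale c M \<in> S)"

definition T_algebra ::
    "('v::finite \<Rightarrow> 'v \<Rightarrow> bool) \<Rightarrow> (nat \<Rightarrow> complex^'v^'v) \<Rightarrow> 'v \<Rightarrow> (complex^'v^'v) set" where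
  "T_algebra adj E x =
     matrix_subalgebra hull {adjacency_matrix adj, dual_adjacency_matrix E x}"

definition matrix_module :: "(complex^'n^'n) set \<Rightarrow> (complex^'n) set \<Rightarrow> bool" where
  "matrix_module T W \<longleftrightarrow> vec.subspace W \<and> (\<forall>B\<in>T. \<forall>w\<in>W. B *v w \<in> W)"

definition irreducible_matrix_module :: "(complex^'n^'n) set \<Rightarrow> (complex^'n) set \<Rightarrow> bool" where
  "irreducible_matrix_module T W \<longleftrightarrow>
     matrix_module T W \<and> W \<noteq> {0} \<and>
     (\<forall>U. matrix_module T U \<and> U \<subseteq> W \<longrightarrow> U = {0} \<or> U = W)"

text \<open>The indices \<open>i \<le> D\<close> with $F_i W \neq 0$.\<close>

definition module_support :: "nat \<Rightarrow> (nat \<Rightarrow> complex^'n^'n) \<Rightarrow> (complex^'n) set \<Rightarrow> nat set" where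
  "module_support D F W = {i. i \<le> D \<and> (*v) (F i) ` W \<noteq> {0}}"

definition endpoint :: "('v::finite \<Rightarrow> 'v \<Rightarrow> bool) \<Rightarrow> 'v \<Rightarrow> (complex^'v) set \<Rightarrow> nat" where
  "endpoint adj x W = Min (module_support (graph_diameter adj) (dual_idempotent adj x) W)"

definition dual_endpoint ::
    "('v::finite \<Rightarrow> 'v \<Rightarrow> bool) \<Rightarrow> (nat \<Rightarrow> complex^'v^'v) \<Rightarrow> (complex^'v) set \<Rightarrow> nat" where
  "dual_endpoint adj E W = Min (module_support (graph_diameter adj) E W)"

definition module_diameter :: "('v::finite \<Rightarrow> 'v \<Rightarrow> bool) \<Rightarrow> 'v \<Rightarrow> (complex^'v) set \<Rightarrow> nat" where
  "module_diameter adj x W =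
     card (module_support (graph_diameter adj) (dual_idempotent adj x) W) - 1"

definition displacement ::
    "('v::finite \<Rightarrow> 'v \<Rightarrow> bool) \<Rightarrow> (nat \<Rightarrow> complex^'v^'v) \<Rightarrow> 'v \<Rightarrow> (complex^'v) set \<Rightarrow> int" where
  "displacement adj E x W =
     int (endpoint adj x W) + int (dual_endpoint adj E W)
       - int (graph_diameter adj) + int (module_diameter adj x W)"

definition nucleus ::
    "('v::finite \<Rightarrow> 'v \<Rightarrow> bool) \<Rightarrow> (nat \<Rightarrow> complex^'v^'v) \<Rightarrow> 'v \<Rightarrow> (complex^'v) set" where
  "nucleus adj E x =
     vec.span (\<Union>{W. irreducible_matrix_module (T_algebra adj E x) W \<and> displacement adj E x W = 0})"

definition nucleus_part ::
    "('v::finite \<Rightarrow> 'v \<Rightarrow> bool) \<Rightarrow> (nat \<Rightarrow> complex^'v^'v) \<Rightarrow> 'v \<Rightarrow> nat \<Rightarrow> (complex^'v) set" where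
  "nucleus_part adj E x i =
     (\<Sum>j\<le>i. range ((*v) (dual_idempotent adj x j))) \<inter>
     (\<Sum>j\<le>graph_diameter adj - i. range ((*v) (E j)))"

end

theory Submission
  imports Defs
begin

text \<open>
  Write $A_D$ for the distance-\<open>D\<close> matrix and $A^*_D$ for the diagonal matrix with entries
  $|X| (E_D)_{x,y}$. For a \<open>T\<close>-module \<open>W\<close> and a number \<open>K\<close> let $L_i$ consist of the vectors of \<open>W\<close>
  in $(E^*_0V + \cdots + E^*_iV) \cap (E_0V + \cdots + E_{K-i}V)$. Since \<open>A\<close> is tridiagonal with respect
  to the $E^*_iV$ and $A^*$ with respect to the $E_iV$, a suitable shift of \<open>A\<close> maps $L_i$ to $L_{i+1}$
  and a suitable shift of $A^*$ maps $L_i$ to $L_{i-1}$; hence $\sum_i L_i$ is a \<open>T\<close>-module.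

  Let \<open>W\<close> be irreducible, with extreme supports $r \le s$ for the $E^*_i$ and $t \le t'$ for the $E_i$;
  its displacement is $s + t - D$. For $K = s + t$ the module $\sum_i L_i$ contains $E_tW \neq 0$, so it
  is \<open>W\<close>, and therefore $r + t' \le s + t$. As $A_D$ and $A^*_D$ are injective, lie in \<open>T\<close> and only
  connect indices with sum at least \<open>D\<close>, also $r + s \ge D$ and $t + t' \ge D$, whence $s + t \ge D$.
  If $s + t = D$, then $W = \sum_i L_i \subseteq \sum_i \mathcal N_i$. Conversely $\sum_i \mathcal N_i$ is a
  module, so a sum of irreducible ones; for each of these the orthogonal projection onto \<open>W\<close>
  commutes with \<open>T\<close> and shows $W = \sum_i L_i$ with $K = D$, which forces $s + t \le D$.
\<close>

section \<open>Linear algebra\<close>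

lemma matrix_vector_mult_sum:
  fixes M :: "complex^'n^'m"
  shows "M *v (\<Sum>i\<in>I. f i) = (\<Sum>i\<in>I. M *v f i)"
  by (induction I rule: infinite_finite_induct) (auto simp: matrix_vector_right_distrib)

lemma sum_matrix_vector_mult:
  fixes M :: "'i \<Rightarrow> complex^'n^'m"
  shows "(\<Sum>i\<in>I. M i) *v v = (\<Sum>i\<in>I. M i *v v)"
  by (induction I rule: infinite_finite_induct) (auto simp: matrix_vector_mult_add_rdistrib)

lemma scaleR_eq_of_real_smult: "c *\<^sub>R (v :: complex^'n) = of_real c *s v"
  by (simp add: vec_eq_iff scaleR_conv_of_real[where 'a = complex])

lemma linear_matrix_vector_mult: "linear ((*v) (M :: complex^'n^'m))"
  by (rule linearI) (auto simp: matrix_vector_right_distrib scaleR_eq_of_real_smult vector_scalar_commute)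

lemma vec_subspace_imp_subspace:
  fixes S :: "(complex^'n) set"
  assumes "vec.subspace S"
  shows "subspace S"
  using assms by (auto simp: subspace_def vec.subspace_def scaleR_eq_of_real_smult)

lemma set_sum_eq_span_Union:
  fixes S :: "'i \<Rightarrow> (complex^'n) set"
  assumes "finite I" and S: "\<And>i. i \<in> I \<Longrightarrow> vec.subspace (S i)"
  shows "(\<Sum>i\<in>I. S i) = vec.span (\<Union>i\<in>I. S i)"
  using assms
proof (induction I rule: finite_induct)
  case (insert j I)
  have "vec.span (S j) = S j"
    using insert.prems by (simp add: vec.span_eq_iff)
  then have "S j + vec.span (\<Union>i\<in>I. S i) = vec.span (S j \<union> (\<Union>i\<in>I. S i))"
    by (auto simp only: vec.span_Un set_plus_def)
  with insert show ?case by simp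
qed (simp add: set_zero)

text \<open>Applying \<open>B\<close> minus \<open>\<theta> j\<close> deletes the component
  \<open>e j\<close> and rescales every other one by the nonzero
  \<open>\<theta> i - \<theta> j\<close>, so induction on the number of components works. The
  setting is a general real vector space because it serves both vectors and matrices under left
  multiplication.\<close>

lemma eigencomponent_in_subspace:
  fixes B :: "'a::real_vector \<Rightarrow> 'a"
  assumes "finite I" "linear B" "subspace S" "\<And>w. w \<in> S \<Longrightarrow> B w \<in> S" "inj_on \<theta> I"
    and "\<And>i. i \<in> I \<Longrightarrow> B (e i) = \<theta> i *\<^sub>R e i" "(\<Sum>i\<in>I. e i) \<in> S" "i \<in> I"
  shows "e i \<in> S"
  using assms
proof (induction I arbitrary: e i rule: finite_induct)
  case (insert j I)
  let ?w = "\<Sum>i\<in>insert j I. e i"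
  have *: "e k \<in> S" if k: "k \<in> I" for k
  proof -
    define e' where "e' = (\<lambda>i. (\<theta> i - \<theta> j) *\<^sub>R e i)"
    have "B ?w - \<theta> j *\<^sub>R ?w = (\<Sum>i\<in>insert j I. B (e i) - \<theta> j *\<^sub>R e i)"
      using insert.prems(1) by (simp only: linear_sum sum_subtractf scaleR_sum_right)
    also have "\<dots> = (\<Sum>i\<in>insert j I. e' i)"
      using insert.prems(5) by (intro sum.cong) (auto simp: e'_def scaleR_diff_left)
    also have "\<dots> = (\<Sum>i\<in>I. e' i)"
      using insert.hyps by (simp add: e'_def)
    finally have "(\<Sum>i\<in>I. e' i) \<in> S"
      using insert.prems by (metis subspace_diff subspace_mul)
    moreover have "B (e' i) = \<theta> i *\<^sub>R e' i" if "i \<in> I" for i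
      using insert.prems(1,5) that by (simp add: e'_def linear_scale)
    ultimately have "e' k \<in> S"
      using insert.IH[of e' k] insert.prems k by auto
    moreover have "\<theta> k \<noteq> \<theta> j"
      using insert k by (auto simp: inj_on_def)
    then have "e k = (1 / (\<theta> k - \<theta> j)) *\<^sub>R e' k"
      by (simp add: e'_def)
    ultimately show ?thesis
      using insert.prems(2) by (metis subspace_mul)
  qed
  have "e j = ?w - (\<Sum>i\<in>I. e i)"
    using insert.hyps by simp
  moreover have "(\<Sum>i\<in>I. e i) \<in> S"
    using insert.prems(2) * by (simp add: subspace_sum)
  ultimately have "e j \<in> S"
    using insert.prems(2,6) by (metis subspace_diff)
  with * insert.prems(7) show ?case by auto
qed simp

section \<open>Invariant subspaces, self-adjoint matrices and orthogonal projections\<close>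

definition invariant :: "complex^'n^'n \<Rightarrow> (complex^'n) set \<Rightarrow> bool" where
  "invariant M W \<longleftrightarrow> (\<forall>w\<in>W. M *v w \<in> W)"

lemma invariantD: "invariant M W \<Longrightarrow> w \<in> W \<Longrightarrow> M *v w \<in> W"
  by (simp add: invariant_def)

lemma invariant_span:
  assumes "\<And>w. w \<in> S \<Longrightarrow> M *v w \<in> vec.span S"
  shows "invariant M (vec.span S)"
  unfolding invariant_def
proof
  fix w assume "w \<in> vec.span S"
  then show "M *v w \<in> vec.span S"
    by (induction rule: vec.span_induct_alt)
      (auto simp: matrix_vector_right_distrib vector_scalar_commute
            intro!: vec.span_add vec.span_scale vec.span_zero assms)
qed

text \<open>\<open>inner\<close> is the real part of the Hermitian form. As \<open>M\<close> is
  complex linear, the condition is still the full Hermitian one: replace \<open>u\<close> by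
  \<open>\<i> *s u\<close>.\<close>

definition selfadjoint :: "complex^'n^'n \<Rightarrow> bool" where
  "selfadjoint M \<longleftrightarrow> (\<forall>u v. inner (M *v u) v = inner u (M *v v))"

lemma selfadjointD: "selfadjoint M \<Longrightarrow> inner (M *v u) v = inner u (M *v v)"
  by (simp add: selfadjoint_def)

lemma selfadjoint_real_symmetric:
  fixes M :: "complex^'n^'n"
  assumes "\<And>y z. M $ y $ z = of_real (m y z)" "\<And>y z. m y z = m z y"
  shows "selfadjoint M"
  unfolding selfadjoint_def
proof (intro allI)
  fix u v :: "complex^'n"
  have "inner (M *v u) v = (\<Sum>y\<in>UNIV. \<Sum>z\<in>UNIV. m y z * inner (u $ z) (v $ y))"
    by (simp add: inner_vec_def matrix_vector_mult_def assms(1) inner_sum_left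
        flip: scaleR_conv_of_real)
  also have "\<dots> = (\<Sum>z\<in>UNIV. \<Sum>y\<in>UNIV. m z y * inner (u $ z) (v $ y))"
    by (subst sum.swap) (simp add: assms(2))
  also have "\<dots> = inner u (M *v v)"
    by (simp add: inner_vec_def matrix_vector_mult_def assms(1) inner_sum_right
        flip: scaleR_conv_of_real)
  finally show "inner (M *v u) v = inner u (M *v v)" .
qed

lemma inner_smult_right:
  fixes u v :: "complex^'n"
  shows "inner u (c *s v) = inner (cnj c *s u) v"
  by (simp add: inner_vec_def inner_complex_def algebra_simps)

text \<open>The complement is taken for the real inner product, which is the real part of the
  Hermitian one; for a complex subspace both complements agree.\<close>

lemma vec_subspace_orthogonal_comp:
  fixes S :: "(complex^'n) set"
  assumes "vec.subspace S"
  shows "vec.subspace (S\<^sup>\<bottom>)"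
  using assms unfolding vec.subspace_def orthogonal_comp_def orthogonal_def
  by (auto simp: inner_add_right inner_smult_right)

lemma invariant_orthogonal_comp:
  assumes "selfadjoint M" "invariant M S"
  shows "invariant M (S\<^sup>\<bottom>)"
  using assms unfolding invariant_def orthogonal_comp_def orthogonal_def
  by (auto simp flip: selfadjointD)

lemma orthogonal_comp_Int_zero: "u \<in> S \<Longrightarrow> u \<in> S\<^sup>\<bottom> \<Longrightarrow> u = 0"
  by (auto simp: orthogonal_comp_def orthogonal_def)

text \<open>A matrix is delivered so that it can be composed with other matrices. The last property
  is what later carries layers of the whole space into a module.\<close>

lemma orthogonal_projection_exists:
  fixes S :: "(complex^'n) set"
  assumes S: "vec.subspace S"
  obtains P :: "complex^'n^'n" where
    "\<And>v. P *v v \<in> S" "\<And>v. v - P *v v \<in> S\<^sup>\<bottom>"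
    "\<And>v. v \<in> S \<Longrightarrow> P *v v = v" "\<And>v. v \<in> S\<^sup>\<bottom> \<Longrightarrow> P *v v = 0"
    "\<And>M v. invariant M S \<Longrightarrow> invariant M (S\<^sup>\<bottom>) \<Longrightarrow> P *v (M *v v) = M *v (P *v v)"
proof -
  note S' = vec_subspace_orthogonal_comp[OF S]
  have ex: "\<exists>p. p \<in> S \<and> v - p \<in> S\<^sup>\<bottom>" for v
  proof -
    have "v \<in> S + S\<^sup>\<bottom>"
      using subspace_sum_orthogonal_comp[OF vec_subspace_imp_subspace[OF S]] by simp
    then show ?thesis by (auto simp: set_plus_def)
  qed
  define p where "p v = (SOME p. p \<in> S \<and> v - p \<in> S\<^sup>\<bottom>)" for v
  have p: "p v \<in> S" "v - p v \<in> S\<^sup>\<bottom>" for v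
    using someI_ex[OF ex[of v]] by (auto simp: p_def)
  \<comment> \<open>Uniqueness of the decomposition yields linearity of \<open>p\<close> and its
    behaviour on \<open>S\<close>, on the complement and under \<open>M\<close>.\<close>
  have uniq: "p v = q" if "q \<in> S" "v - q \<in> S\<^sup>\<bottom>" for v q
  proof -
    have "p v - q \<in> S"
      using p that S by (simp add: vec.subspace_diff)
    moreover have "(v - q) - (v - p v) \<in> S\<^sup>\<bottom>"
      using p that S' by (blast intro: vec.subspace_diff)
    ultimately show ?thesis
      using orthogonal_comp_Int_zero[of "p v - q" S] by simp
  qed
  have "Vector_Spaces.linear (*s) (*s) p"
  proof (rule Vector_Spaces.linear.intro; (intro module_hom.intro module_hom_axioms.intro vec.vector_space_axioms vec.module_axioms)?)
    fix u v c
    have "(u - p u) + (v - p v) \<in> S\<^sup>\<bottom>" "c *s (u - p u) \<in> S\<^sup>\<bottom>"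
      using p S' by (blast intro: vec.subspace_add vec.subspace_scale)+
    then show "p (u + v) = p u + p v" "p (c *s u) = c *s p u"
      using p S by (auto intro!: uniq vec.subspace_add vec.subspace_scale
          simp: algebra_simps vector_ssub_ldistrib vec.scale_right_diff_distrib)
  qed
  then have P: "matrix p *v v = p v" for v
    by (simp add: matrix_works)
  show ?thesis
  proof (rule that[of "matrix p"]; (unfold P)?)
    show "p v = v" if "v \<in> S" for v
      using that vec.subspace_0[OF S'] by (intro uniq) auto
    show "p v = 0" if "v \<in> S\<^sup>\<bottom>" for v
      using that vec.subspace_0[OF S] by (intro uniq) auto
    show "p (M *v v) = M *v p v" if "invariant M S" "invariant M (S\<^sup>\<bottom>)" for M v
      using that p[of v] by (intro uniq) (auto dest: invariantD simp flip: matrix_vector_mult_diff_distrib)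
  qed (use p in auto)
qed

section \<open>Modules for a pair of matrices\<close>

definition pair_module :: "complex^'n^'n \<Rightarrow> complex^'n^'n \<Rightarrow> (complex^'n) set \<Rightarrow> bool" where
  "pair_module A B W \<longleftrightarrow> vec.subspace W \<and> invariant A W \<and> invariant B W"

definition irreducible_pair_module ::
    "complex^'n^'n \<Rightarrow> complex^'n^'n \<Rightarrow> (complex^'n) set \<Rightarrow> bool" where
  "irreducible_pair_module A B W \<longleftrightarrow> pair_module A B W \<and> W \<noteq> {0} \<and>
     (\<forall>U. pair_module A B U \<and> U \<subseteq> W \<longrightarrow> U = {0} \<or> U = W)"

lemma pair_module_commute: "pair_module A B W \<longleftrightarrow> pair_module B A W"
  by (auto simp: pair_module_def)

lemma irreducible_pair_module_commute:
  "irreducible_pair_module A B W \<longleftrightarrow> irreducible_pair_module B A W"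
  by (simp add: irreducible_pair_module_def pair_module_commute[of A B])

lemma matrix_scale_vector_mult: "matrix_scale c M *v w = c *s (M *v w)"
  by (simp add: vec_eq_iff matrix_scale_def matrix_vector_mult_def sum_distrib_left mult.assoc)

lemma matrix_subalgebra_invariant:
  "vec.subspace W \<Longrightarrow> matrix_subalgebra {M. invariant M W}"
  unfolding matrix_subalgebra_def invariant_def
  by (simp add: matrix_vector_mult_add_rdistrib vec.subspace_add vec.subspace_scale
      matrix_scale_vector_mult flip: matrix_vector_mul_assoc)

text \<open>A generator that is scalar on \<open>S\<close> forces everything it generates to be
  scalar there. This later gives the expansion of distance matrices in the \<open>E l\<close> and
  the distinctness of the dual eigenvalues.\<close>

lemma matrix_subalgebra_scalar_on:
  "matrix_subalgebra {M. \<exists>c. \<forall>v\<in>S. M *v v = c *s v}"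
proof -
  have "\<exists>c. \<forall>v\<in>S. mat 1 *v v = c *s v"
    by (intro exI[of _ 1]) simp
  moreover have "\<exists>c. \<forall>v\<in>S. (M + N) *v v = c *s v" "\<exists>c. \<forall>v\<in>S. (M ** N) *v v = c *s v"
    "\<exists>c. \<forall>v\<in>S. matrix_scale d M *v v = c *s v"
    if "\<forall>v\<in>S. M *v v = a *s v" "\<forall>v\<in>S. N *v v = b *s v" for M N a b d
  proof -
    show "\<exists>c. \<forall>v\<in>S. (M + N) *v v = c *s v"
      using that by (intro exI[of _ "a + b"]) (simp add: matrix_vector_mult_add_rdistrib vec.scale_left_distrib)
    show "\<exists>c. \<forall>v\<in>S. (M ** N) *v v = c *s v"
      using that by (intro exI[of _ "a * b"])
        (simp add: vector_scalar_commute mult.commute flip: matrix_vector_mul_assoc)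
    show "\<exists>c. \<forall>v\<in>S. matrix_scale d M *v v = c *s v"
      using that by (intro exI[of _ "d * a"]) (simp add: matrix_scale_vector_mult)
  qed
  ultimately show ?thesis
    unfolding matrix_subalgebra_def by blast
qed

text \<open>The matrices that preserve \<open>W\<close> form a subalgebra, so invariance under the
  two generators passes to the hull.\<close>

lemma matrix_module_generated:
  fixes A B :: "complex^'n^'n"
  shows "matrix_module (matrix_subalgebra hull {A, B}) W \<longleftrightarrow> pair_module A B W"
proof
  assume "matrix_module (matrix_subalgebra hull {A, B}) W"
  then show "pair_module A B W"
    using hull_subset[of "{A, B}" matrix_subalgebra]
    by (auto simp: matrix_module_def pair_module_def invariant_def)
next
  assume W: "pair_module A B W"
  then have "matrix_subalgebra {M. invariant M W}"
    by (simp add: pair_module_def matrix_subalgebra_invariant)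
  then have "matrix_subalgebra hull {A, B} \<subseteq> {M. invariant M W}"
    using W by (intro hull_minimal) (auto simp: pair_module_def)
  then show "matrix_module (matrix_subalgebra hull {A, B}) W"
    using W by (auto simp: matrix_module_def pair_module_def invariant_def)
qed

lemma irreducible_matrix_module_generated:
  "irreducible_matrix_module (matrix_subalgebra hull {A, B}) W \<longleftrightarrow> irreducible_pair_module A B W"
  by (simp add: irreducible_matrix_module_def irreducible_pair_module_def matrix_module_generated)

text \<open>Take a nonzero submodule of least dimension.\<close>

lemma irreducible_pair_module_exists:
  assumes "pair_module A B M" "M \<noteq> {0}"
  obtains W where "irreducible_pair_module A B W" "W \<subseteq> M"
proof -
  let ?P = "\<lambda>W. pair_module A B W \<and> W \<noteq> {0} \<and> W \<subseteq> M"
  obtain W where W: "?P W" and min: "\<And>U. ?P U \<Longrightarrow> vec.dim W \<le> vec.dim U"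
    using assms ex_has_least_nat[of ?P M vec.dim] by auto
  have "U = W" if "pair_module A B U" "U \<subseteq> W" "U \<noteq> {0}" for U
    using that W min[of U] by (intro vec.subspace_dim_equal) (auto simp: pair_module_def)
  with W that show ?thesis
    unfolding irreducible_pair_module_def by blast
qed

text \<open>Complete reducibility: if the irreducible submodules did not span \<open>M\<close>, the
  orthogonal complement of their span within \<open>M\<close> would be a nonzero module and contain
  a further irreducible one, orthogonal to itself.\<close>

lemma pair_module_span_irreducible:
  assumes "selfadjoint A" "selfadjoint B" and M: "pair_module A B M"
  shows "M = vec.span (\<Union>{W. irreducible_pair_module A B W \<and> W \<subseteq> M})" (is "_ = vec.span ?S")
proof (rule ccontr)
  let ?U = "vec.span ?S"
  assume neq: "M \<noteq> ?U"
  have sub: "vec.subspace M" using M by (simp add: pair_module_def)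
  then have U: "?U \<subseteq> M"
    by (intro vec.span_minimal) auto
  have inv: "invariant X ?U" if X: "\<And>W. pair_module A B W \<Longrightarrow> invariant X W" for X
  proof (rule invariant_span)
    fix w assume "w \<in> ?S"
    then obtain W where W: "irreducible_pair_module A B W" "W \<subseteq> M" "w \<in> W" by auto
    then have "X *v w \<in> W"
      using X[of W] by (simp add: irreducible_pair_module_def invariant_def)
    with W show "X *v w \<in> ?U"
      by (intro vec.span_base) auto
  qed
  obtain P where P: "\<And>v. P *v v \<in> ?U" "\<And>v. v - P *v v \<in> ?U\<^sup>\<bottom>"
    by (rule orthogonal_projection_exists[OF vec.subspace_span[of ?S]]) blast
  from neq U obtain m where m: "m \<in> M" "m \<notin> ?U" by auto
  let ?N = "M \<inter> ?U\<^sup>\<bottom>"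
  have "m - P *v m \<in> ?N"
    using P[of m] U m vec.subspace_diff[OF sub, of m "P *v m"] by blast
  moreover have "m - P *v m \<noteq> 0"
    using P(1)[of m] m by auto
  ultimately have "?N \<noteq> {0}" by (metis singletonD)
  moreover have "pair_module A B ?N"
    using M invariant_orthogonal_comp[OF assms(1) inv[of A]]
      invariant_orthogonal_comp[OF assms(2) inv[of B]] vec_subspace_orthogonal_comp[of ?U]
    by (simp add: pair_module_def invariant_def vec.subspace_inter)
  ultimately obtain W where W: "irreducible_pair_module A B W" "W \<subseteq> ?N"
    using irreducible_pair_module_exists by blast
  then have "W \<subseteq> ?U"
    using vec.span_superset[of ?S] by blast
  with W have "W \<subseteq> {0}"
    using orthogonal_comp_Int_zero by blast
  moreover have "0 \<in> W"
    using W by (auto simp: irreducible_pair_module_def pair_module_def vec.subspace_0)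
  ultimately show False
    using W by (auto simp: irreducible_pair_module_def)
qed

section \<open>Tridiagonal systems\<close>

text \<open>In the application \<open>C\<close> is the distance matrix $A_D$ or its dual $A^*_D$.\<close>

locale tridiagonal_system =
  fixes D :: nat and A B C :: "complex^'n^'n" and \<theta> :: "nat \<Rightarrow> real" and E :: "nat \<Rightarrow> complex^'n^'n"
  assumes sum_E: "(\<Sum>i\<le>D. E i *v v) = v"
    and E_E: "i \<le> D \<Longrightarrow> j \<le> D \<Longrightarrow> E i *v (E j *v v) = (if i = j then E j *v v else 0)"
    and A_E: "i \<le> D \<Longrightarrow> A *v (E i *v v) = of_real (\<theta> i) *s (E i *v v)"
    and inj_\<theta>: "inj_on \<theta> {..D}"
    and tridiagonal: "h \<le> D \<Longrightarrow> j \<le> D \<Longrightarrow> h > Suc j \<or> j > Suc h \<Longrightarrow> E h *v (B *v (E j *v v)) = 0"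
    and C_inj: "C *v v = 0 \<Longrightarrow> v = 0"
    and C_invariant: "vec.subspace W \<Longrightarrow> invariant B W \<Longrightarrow> invariant C W"
    and C_far: "h \<le> D \<Longrightarrow> j \<le> D \<Longrightarrow> h + j < D \<Longrightarrow> E h *v (C *v (E j *v v)) = 0"
begin

lemma E_A:
  assumes "j \<le> D"
  shows "E j *v (A *v w) = of_real (\<theta> j) *s (E j *v w)"
proof -
  have "E j *v (A *v w) = E j *v (A *v (\<Sum>i\<le>D. E i *v w))"
    by (simp add: sum_E)
  also have "\<dots> = (\<Sum>i\<le>D. if j = i then of_real (\<theta> j) *s (E j *v w) else 0)"
    unfolding matrix_vector_mult_sum
    by (intro sum.cong) (auto simp: A_E E_E vector_scalar_commute assms)
  finally show ?thesis
    using assms by simp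
qed

lemma E_A_shift:
  assumes "j \<le> D"
  shows "E j *v (A *v w - of_real c *s w) = of_real (\<theta> j - c) *s (E j *v w)"
  using assms
  by (simp add: matrix_vector_mult_diff_distrib E_A vector_scalar_commute vec.scale_left_diff_distrib)

lemma E_zero_imp_zero: "(\<And>i. i \<le> D \<Longrightarrow> E i *v w = 0) \<Longrightarrow> w = 0"
  using sum_E[of w] by simp

text \<open>The vectors \<open>E i *v w\<close> are the eigencomponents of \<open>w\<close> under
  \<open>A\<close>, so they can be separated inside \<open>W\<close>.\<close>

lemma E_invariant:
  assumes "vec.subspace W" "invariant A W" "i \<le> D"
  shows "invariant (E i) W"
  unfolding invariant_def
proof
  fix w assume w: "w \<in> W"
  show "E i *v w \<in> W"
    by (rule eigencomponent_in_subspace[where B = "(*v) A" and I = "{..D}" and \<theta> = \<theta>])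
      (use assms w inj_\<theta> in \<open>auto simp: linear_matrix_vector_mult sum_E A_E invariant_def
        vec_subspace_imp_subspace scaleR_eq_of_real_smult\<close>)
qed

lemma E_B_eq_zero:
  assumes "\<And>k. k \<le> D \<Longrightarrow> m < k \<Longrightarrow> E k *v w = 0" "j \<le> D" "Suc m < j"
  shows "E j *v (B *v w) = 0"
proof -
  have "E j *v (B *v w) = (\<Sum>k\<le>D. E j *v (B *v (E k *v w)))"
    by (simp add: sum_E flip: matrix_vector_mult_sum)
  also have "\<dots> = 0"
  proof (intro sum.neutral ballI)
    fix k assume "k \<in> {..D}"
    then show "E j *v (B *v (E k *v w)) = 0"
      using assms tridiagonal[of j k w] by (cases "m < k") auto
  qed
  finally show ?thesis .
qed

lemma mem_module_support:
  "vec.subspace W \<Longrightarrow> i \<in> module_support D E W \<longleftrightarrow> i \<le> D \<and> (\<exists>w\<in>W. E i *v w \<noteq> 0)"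
  using vec.subspace_0[of W] by (fastforce simp: module_support_def)

lemma finite_module_support: "finite (module_support D E W)"
  by (simp add: module_support_def)

lemma module_support_nonempty:
  assumes "vec.subspace W" "W \<noteq> {0}"
  shows "module_support D E W \<noteq> {}"
proof -
  obtain w where "w \<in> W" "w \<noteq> 0"
    using assms vec.subspace_0[of W] by blast
  then show ?thesis
    using E_zero_imp_zero[of w] mem_module_support[OF assms(1)] by blast
qed

lemma support_bounds:
  assumes "vec.subspace W" "w \<in> W" "i \<le> D" "E i *v w \<noteq> 0"
  shows "Min (module_support D E W) \<le> i" and "i \<le> Max (module_support D E W)"
  using assms finite_module_support mem_module_support by (auto intro!: Min_le Max_ge)

lemma support_extremes:
  assumes "vec.subspace W" "W \<noteq> {0}"
  obtains v w where "v \<in> W" "Min (module_support D E W) \<le> D" "E (Min (module_support D E W)) *v v \<noteq> 0"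
    "w \<in> W" "Max (module_support D E W) \<le> D" "E (Max (module_support D E W)) *v w \<noteq> 0"
  using Min_in[OF finite_module_support module_support_nonempty[OF assms]]
    Max_in[OF finite_module_support module_support_nonempty[OF assms]]
    mem_module_support[OF assms(1)] that by blast

text \<open>Apply \<open>C\<close> to a nonzero component at the lowest index r. The image is
  nonzero and lies in \<open>W\<close>, and \<open>C\<close> reaches from r only indices h with
  \<open>h + r \<ge> D\<close>; so such an h is in the support.\<close>

lemma diameter_le_Min_plus_Max:
  assumes W: "pair_module A B W" "W \<noteq> {0}"
  shows "D \<le> Min (module_support D E W) + Max (module_support D E W)"
proof -
  let ?r = "Min (module_support D E W)"
  have W': "vec.subspace W" "invariant A W" "invariant B W"
    using W by (auto simp: pair_module_def)
  obtain v where v: "v \<in> W" "?r \<le> D" "E ?r *v v \<noteq> 0"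
    using support_extremes[OF W'(1) W(2)] by blast
  have Ev: "E ?r *v v \<in> W"
    using E_invariant v W' by (auto dest: invariantD)
  then have CEv: "C *v (E ?r *v v) \<in> W"
    using C_invariant W' by (auto dest: invariantD)
  have "C *v (E ?r *v v) \<noteq> 0"
    using C_inj v by blast
  then obtain h where h: "h \<le> D" "E h *v (C *v (E ?r *v v)) \<noteq> 0"
    using E_zero_imp_zero by blast
  then have "D \<le> h + ?r"
    using C_far[of h ?r v] v by force
  moreover have "h \<le> Max (module_support D E W)"
    using support_bounds[OF W'(1) CEv h] by simp
  ultimately show ?thesis by linarith
qed

text \<open>If an index i between the extremes were missing, the vectors of \<open>W\<close>
  supported strictly below i would form a proper nonzero submodule, since the tridiagonal
  \<open>B\<close> cannot jump across i.\<close>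

lemma irreducible_support_interval:
  assumes irr: "irreducible_pair_module A B W"
  shows "module_support D E W = {Min (module_support D E W)..Max (module_support D E W)}"
proof (rule ccontr)
  let ?S = "module_support D E W"
  have W': "vec.subspace W" "invariant A W" "invariant B W" "W \<noteq> {0}"
    using irr by (auto simp: pair_module_def irreducible_pair_module_def)
  note mem = mem_module_support[OF W'(1)]
  assume "\<not> ?thesis"
  then obtain i where i: "Min ?S \<le> i" "i \<le> Max ?S" "i \<notin> ?S"
    using finite_module_support[of W] Min_le Max_ge by (metis atLeastAtMost_iff subsetI subset_antisym)
  obtain v w where vw: "v \<in> W" "Min ?S \<le> D" "E (Min ?S) *v v \<noteq> 0"
    "w \<in> W" "Max ?S \<le> D" "E (Max ?S) *v w \<noteq> 0"
    using support_extremes[OF W'(1,4)] by metis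
  then have i': "Min ?S < i" "i < Max ?S"
    using i mem by (metis le_neq_implies_less)+
  then have Ei: "E i *v u = 0" if "u \<in> W" for u
    using i mem that vw by auto
  define U where "U = {u \<in> W. \<forall>j\<le>D. i \<le> j \<longrightarrow> E j *v u = 0}"
  have "vec.subspace U"
    using W'(1) by (auto simp: U_def vec.subspace_def matrix_vector_right_distrib vector_scalar_commute)
  moreover have "invariant A U"
    using W' by (auto simp: U_def invariant_def E_A)
  moreover have "E j *v (B *v u) = 0" if u: "u \<in> U" and j: "j \<le> D" "i \<le> j" for u j
  proof (cases "j = i")
    case True
    then show ?thesis using Ei[of "B *v u"] u W'(3) by (auto simp: U_def invariant_def)
  next
    case False
    \<comment> \<open>Components of \<open>u\<close> above \<open>i - 1\<close> vanish;
      \<open>i\<close> is positive because it exceeds the minimum, so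
      \<open>Suc (i - 1) = i < j\<close>.\<close>
    then show ?thesis
      using E_B_eq_zero[of "i - 1" u j] u j i' by (auto simp: U_def)
  qed
  then have "invariant B U"
    using W'(3) by (auto simp: U_def invariant_def)
  ultimately have "pair_module A B U"
    by (simp add: pair_module_def)
  then have "U = {0} \<or> U = W"
    using irr by (auto simp: irreducible_pair_module_def U_def)
  moreover have "w \<notin> U"
    using vw i' by (auto simp: U_def)
  moreover have "E (Min ?S) *v v \<in> U"
    using vw i' E_invariant[OF W'(1,2) vw(2)] by (auto simp: U_def E_E invariant_def)
  ultimately show False
    using vw by auto
qed

end

section \<open>Pairs of dual tridiagonal systems, their layers and displacement\<close>

locale tridiagonal_pair =
  P: tridiagonal_system D A As Cs \<theta> E + Q: tridiagonal_system D As A C \<theta>s Es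
  for D :: nat and A As C Cs :: "complex^'n^'n" and \<theta> \<theta>s :: "nat \<Rightarrow> real"
    and E Es :: "nat \<Rightarrow> complex^'n^'n" +
  assumes selfadjoint_A: "selfadjoint A" and selfadjoint_As: "selfadjoint As"
begin

text \<open>Vanishing components replace the intersection of two sums of ranges. Writing
  \<open>K < i + j\<close> avoids truncated subtraction: for \<open>i > K\<close> the layer is
  zero.\<close>

definition layer :: "nat \<Rightarrow> (complex^'n) set \<Rightarrow> nat \<Rightarrow> (complex^'n) set" where
  "layer K W i = {w \<in> W. (\<forall>j\<le>D. i < j \<longrightarrow> Es j *v w = 0) \<and> (\<forall>j\<le>D. K < i + j \<longrightarrow> E j *v w = 0)}"

definition layer_span :: "nat \<Rightarrow> (complex^'n) set \<Rightarrow> (complex^'n) set" where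
  "layer_span K W = vec.span (\<Union>i. layer K W i)"

lemma layer_mono: "U \<subseteq> W \<Longrightarrow> layer K U i \<subseteq> layer K W i"
  by (auto simp: layer_def)

lemma layer_span_mono: "U \<subseteq> W \<Longrightarrow> layer_span K U \<subseteq> layer_span K W"
  unfolding layer_span_def by (intro vec.span_mono UN_mono layer_mono order_refl)

lemma layer_span_base: "w \<in> layer K W i \<Longrightarrow> w \<in> layer_span K W"
  unfolding layer_span_def by (rule vec.span_base) blast

lemma layer_span_subset: "vec.subspace W \<Longrightarrow> layer_span K W \<subseteq> W"
  unfolding layer_span_def by (intro vec.span_minimal) (auto simp: layer_def)

lemma subspace_layer_span: "vec.subspace (layer_span K W)"
  by (simp add: layer_span_def)

lemma subspace_layer: "vec.subspace W \<Longrightarrow> vec.subspace (layer K W i)"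
  by (auto simp: layer_def vec.subspace_def matrix_vector_right_distrib vector_scalar_commute)

lemma shift_mem:
  assumes "pair_module A As W" "w \<in> W"
  shows "A *v w - c *s w \<in> W" "As *v w - c *s w \<in> W"
  using assms by (auto simp: pair_module_def intro!: vec.subspace_diff vec.subspace_scale dest: invariantD)

text \<open>On layer \<open>i\<close> the shift by the topmost eigenvalue of \<open>A\<close> occurring there raises \<open>i\<close> by one, and
  the analogous shift of \<open>As\<close> lowers \<open>i\<close> by one.\<close>

lemma A_layer:
  assumes W: "pair_module A As W" and w: "w \<in> layer K W i"
  obtains c where "A *v w - c *s w \<in> layer K W (Suc i)"
proof -
  \<comment> \<open>\<open>K - i\<close> is the highest index with a possibly nonzero component, and
    only there does the new layer demand more. If it exceeds \<open>D\<close>, nothing is demanded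
    and the default 0 is harmless; if \<open>i > K\<close>, truncation gives index 0, but then
    \<open>w\<close> is zero.\<close>
  let ?c = "if K - i \<le> D then \<theta> (K - i) else 0"
  let ?u = "A *v w - of_real ?c *s w"
  have "?u \<in> W"
    using shift_mem[OF W] w by (simp add: layer_def)
  moreover have "Es j *v ?u = 0" if j: "j \<le> D" "Suc i < j" for j
  proof -
    have "Es j *v (A *v w) = 0"
      using w j by (intro Q.E_B_eq_zero[of i]) (auto simp: layer_def)
    moreover have "Es j *v w = 0"
      using w j by (auto simp: layer_def)
    ultimately show ?thesis
      by (simp add: matrix_vector_mult_diff_distrib vector_scalar_commute)
  qed
  moreover have "E j *v ?u = 0" if j: "j \<le> D" "K < Suc i + j" for j
  proof -
    have "j = K - i \<and> K - i \<le> D \<or> E j *v w = 0"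
      using w j by (cases "K < i + j") (auto simp: layer_def)
    then show ?thesis
      using P.E_A_shift[OF j(1), of w ?c] by auto
  qed
  ultimately have "?u \<in> layer K W (Suc i)"
    by (simp add: layer_def)
  then show ?thesis by (rule that)
qed

lemma As_layer:
  assumes W: "pair_module A As W" and w: "w \<in> layer K W i"
  obtains c where "As *v w - c *s w \<in> layer K W (i - 1)"
proof -
  let ?c = "if i \<le> D then \<theta>s i else 0"
  let ?u = "As *v w - of_real ?c *s w"
  have "?u \<in> W"
    using shift_mem[OF W] w by (simp add: layer_def)
  \<comment> \<open>For \<open>i = 0\<close> the target layer is again 0. The second disjunct then
    covers every \<open>j\<close>: \<open>w\<close> lies in one eigenspace of \<open>As\<close>, so
    the shift annihilates it.\<close>
  moreover have Es: "Es j *v ?u = 0" if j: "j \<le> D" "i - 1 < j \<or> i = 0" for j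
  proof -
    have "j = i \<or> Es j *v w = 0"
      using w j by (cases "i < j") (auto simp: layer_def)
    then show ?thesis
      using Q.E_A_shift[OF j(1), of w ?c] j by auto
  qed
  moreover have "E j *v ?u = 0" if j: "j \<le> D" "K < i - 1 + j" for j
  proof (cases "i = 0")
    case True
    have "?u = 0"
      by (rule Q.E_zero_imp_zero, rule Es) (use True in auto)
    then show ?thesis by simp
  next
    case False
    have "E j *v (As *v w) = 0"
    proof (cases "i \<le> K")
      case True
      with w j \<open>i \<noteq> 0\<close> show ?thesis
        by (intro P.E_B_eq_zero[of "K - i"]) (auto simp: layer_def)
    next
      case False
      have "w = 0"
        by (rule P.E_zero_imp_zero) (use False w in \<open>auto simp: layer_def\<close>)
      then show ?thesis by simp
    qed
    moreover have "E j *v w = 0"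
      using w j False by (auto simp: layer_def)
    ultimately show ?thesis
      by (simp add: matrix_vector_mult_diff_distrib vector_scalar_commute)
  qed
  ultimately have "?u \<in> layer K W (i - 1)"
    by (simp add: layer_def)
  then show ?thesis by (rule that)
qed

text \<open>The shifts differ from \<open>A\<close> and \<open>As\<close> only by a multiple of
  \<open>w\<close>, which is itself in the span.\<close>

lemma pair_module_layer_span:
  assumes W: "pair_module A As W"
  shows "pair_module A As (layer_span K W)"
proof -
  have shift: "X *v w \<in> layer_span K W"
    if "X *v w - c *s w \<in> layer K W j" "w \<in> layer K W i" for X w c i j
  proof -
    have "(X *v w - c *s w) + c *s w \<in> layer_span K W"
      using that layer_span_base subspace_layer_span
      by (blast intro: vec.subspace_add vec.subspace_scale)
    then show ?thesis by simp
  qed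
  have "invariant A (layer_span K W)"
    unfolding layer_span_def
    by (rule invariant_span, fold layer_span_def) (metis UN_E A_layer[OF W] shift)
  moreover have "invariant As (layer_span K W)"
    unfolding layer_span_def
    by (rule invariant_span, fold layer_span_def) (metis UN_E As_layer[OF W] shift)
  ultimately show ?thesis
    by (simp add: pair_module_def subspace_layer_span)
qed

text \<open>Moves a nonvanishing statement from the sum of the layers to a single layer, where the
  index bounds apply.\<close>

lemma layer_not_annihilated:
  assumes "M *v w \<noteq> 0" "w \<in> layer_span K W"
  obtains i u where "u \<in> layer K W i" "M *v u \<noteq> 0"
proof -
  have "M *v w = 0" if *: "\<And>i u. u \<in> layer K W i \<Longrightarrow> M *v u = 0"
    using assms(2) unfolding layer_span_def
    by (induction rule: vec.span_induct_alt)
      (auto simp: matrix_vector_right_distrib vector_scalar_commute *)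
  with assms that show ?thesis by blast
qed

abbreviation "supp W \<equiv> module_support D E W"
abbreviation "supps W \<equiv> module_support D Es W"

text \<open>This \<open>K\<close> is chosen so that a nonzero vector of \<open>E ?t\<close> applied
  to \<open>W\<close> fits into layer \<open>?s\<close>: its dual indices are at most
  \<open>?s\<close>, its only index is \<open>?t\<close>. Irreducibility does the rest.\<close>

lemma irreducible_eq_layer_span:
  assumes irr: "irreducible_pair_module A As W"
  shows "layer_span (Max (supps W) + Min (supp W)) W = W"
proof -
  let ?s = "Max (supps W)" and ?t = "Min (supp W)"
  have W: "pair_module A As W" "vec.subspace W" "invariant A W" "W \<noteq> {0}"
    using irr by (auto simp: irreducible_pair_module_def pair_module_def)
  obtain w where w: "w \<in> W" "?t \<le> D" "E ?t *v w \<noteq> 0"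
    using P.support_extremes[OF W(2,4)] by blast
  have EW: "E ?t *v w \<in> W"
    using P.E_invariant W w by (auto dest: invariantD)
  have "Es j *v (E ?t *v w) = 0" if "j \<le> D" "?s < j" for j
    using Q.support_bounds(2)[OF W(2) EW that(1)] that(2) by force
  then have "E ?t *v w \<in> layer (?s + ?t) W ?s"
    using EW w by (auto simp: layer_def P.E_E)
  then have "layer_span (?s + ?t) W \<noteq> {0}"
    using layer_span_base w by blast
  then show ?thesis
    using irr pair_module_layer_span[OF W(1)] layer_span_subset[OF W(2)]
    unfolding irreducible_pair_module_def by blast
qed

text \<open>Let r and s be the extreme dual indices of \<open>W\<close>, and t and T the other
  extremes. As the layers for \<open>K = s + t\<close> fill \<open>W\<close>, one of them has a
  vector with nonzero component T; it also has a dual index h with r \<le> h \<le> i, whence r + T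
  \<le> s + t.\<close>

lemma diameter_le_Max_plus_Min:
  assumes irr: "irreducible_pair_module A As W"
  shows "D \<le> Max (supps W) + Min (supp W)"
proof -
  let ?K = "Max (supps W) + Min (supp W)"
  have W: "pair_module A As W" "vec.subspace W" "W \<noteq> {0}"
    using irr by (auto simp: irreducible_pair_module_def pair_module_def)
  obtain w where w: "w \<in> W" "Max (supp W) \<le> D" "E (Max (supp W)) *v w \<noteq> 0"
    using P.support_extremes[OF W(2,3)] by blast
  then have "w \<in> layer_span ?K W"
    using irreducible_eq_layer_span[OF irr] by simp
  then obtain i u where u: "u \<in> layer ?K W i" "E (Max (supp W)) *v u \<noteq> 0"
    using layer_not_annihilated[OF w(3)] by blast
  then have "i + Max (supp W) \<le> ?K"
    using w(2) by (force simp: layer_def)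
  moreover have "u \<noteq> 0" "u \<in> W"
    using u by (auto simp: layer_def)
  then obtain h where h: "h \<le> D" "Es h *v u \<noteq> 0"
    using Q.E_zero_imp_zero by blast
  then have "h \<le> i"
    using u(1) by (force simp: layer_def)
  moreover have "Min (supps W) \<le> h"
    using Q.support_bounds(1)[OF W(2) \<open>u \<in> W\<close> h] .
  moreover have "D \<le> Min (supp W) + Max (supp W)"
    using P.diameter_le_Min_plus_Max W by blast
  moreover have "D \<le> Min (supps W) + Max (supps W)"
    using Q.diameter_le_Min_plus_Max W pair_module_commute by blast
  \<comment> \<open>In that notation, 2D \<le> (r + s) + (t + T) \<le> 2(s + t).\<close>
  ultimately show ?thesis by linarith
qed

text \<open>The layers containing pieces of \<open>W\<close> belong to the whole space. Projecting
  orthogonally onto \<open>W\<close> commutes with \<open>A\<close> and \<open>As\<close>, hence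
  with all \<open>E j\<close> and \<open>Es j\<close>, and so maps them into layers of
  \<open>W\<close>.\<close>

lemma Max_plus_Min_le_diameter:
  assumes irr: "irreducible_pair_module A As W" and sub: "W \<subseteq> layer_span D UNIV"
  shows "Max (supps W) + Min (supp W) \<le> D"
proof -
  have W: "pair_module A As W" "vec.subspace W" "W \<noteq> {0}" "invariant A W" "invariant As W"
    using irr by (auto simp: irreducible_pair_module_def pair_module_def)
  obtain R where R: "\<And>v. R *v v \<in> W" "\<And>v. v \<in> W \<Longrightarrow> R *v v = v"
    "\<And>M v. invariant M W \<Longrightarrow> invariant M (W\<^sup>\<bottom>) \<Longrightarrow> R *v (M *v v) = M *v (R *v v)"
    by (rule orthogonal_projection_exists[OF W(2)]) blast
  note Wperp = vec_subspace_orthogonal_comp[OF W(2)]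
    invariant_orthogonal_comp[OF selfadjoint_A W(4)] invariant_orthogonal_comp[OF selfadjoint_As W(5)]
  have comm: "R *v (E j *v v) = E j *v (R *v v)" "R *v (Es j *v v) = Es j *v (R *v v)"
    if "j \<le> D" for j v
    using R(3) P.E_invariant Q.E_invariant W Wperp that by blast+
  have layer_R: "R *v u \<in> layer D W i" if "u \<in> layer D UNIV i" for u i
    using that R(1) by (auto simp: layer_def simp flip: comm)
  obtain w where w: "w \<in> W" "Max (supps W) \<le> D" "Es (Max (supps W)) *v w \<noteq> 0"
    using Q.support_extremes[OF W(2,3)] by blast
  \<comment> \<open>With the projection built into the matrix, the vector found in a layer of the
    whole space keeps its nonzero top dual component after projection.\<close>
  have "(Es (Max (supps W)) ** R) *v w \<noteq> 0"
    using w R(2) by (simp flip: matrix_vector_mul_assoc)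
  then obtain i u where u: "u \<in> layer D UNIV i" "(Es (Max (supps W)) ** R) *v u \<noteq> 0"
    using layer_not_annihilated[of _ w] w sub by blast
  let ?u = "R *v u"
  have u': "?u \<in> layer D W i" "Es (Max (supps W)) *v ?u \<noteq> 0"
    using u layer_R by (auto simp flip: matrix_vector_mul_assoc)
  then have "Max (supps W) \<le> i"
    using w(2) by (force simp: layer_def)
  moreover have "?u \<noteq> 0" "?u \<in> W"
    using u' by (auto simp: layer_def)
  then obtain h where h: "h \<le> D" "E h *v ?u \<noteq> 0"
    using P.E_zero_imp_zero by blast
  then have "i + h \<le> D"
    using u'(1) by (force simp: layer_def)
  moreover have "Min (supp W) \<le> h"
    using P.support_bounds(1)[OF W(2) \<open>?u \<in> W\<close> h] .
  ultimately show ?thesis by linarith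
qed

text \<open>The left side is spanned by its irreducible submodules, and for these the two opposite
  bounds give equality. Conversely, an irreducible module with that equality is its own layer span
  for \<open>K = D\<close>.\<close>

theorem layer_span_eq_span_irreducible:
  "layer_span D UNIV =
     vec.span (\<Union>{W. irreducible_pair_module A As W \<and> Max (supps W) + Min (supp W) = D})"
    (is "_ = vec.span (\<Union>?I)")
proof
  have UNIV: "pair_module A As (UNIV :: (complex^'n) set)"
    by (simp add: pair_module_def invariant_def)
  have "{W. irreducible_pair_module A As W \<and> W \<subseteq> layer_span D UNIV} \<subseteq> ?I"
    using diameter_le_Max_plus_Min Max_plus_Min_le_diameter le_antisym by blast
  from vec.span_mono[OF Union_mono[OF this]]
  show "layer_span D UNIV \<subseteq> vec.span (\<Union>?I)"
    unfolding pair_module_span_irreducible[OF selfadjoint_A selfadjoint_As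
        pair_module_layer_span[OF UNIV], symmetric] .
  have "W \<subseteq> layer_span D UNIV" if "W \<in> ?I" for W
    using that irreducible_eq_layer_span[of W] layer_span_mono[of W UNIV D] by auto
  then show "vec.span (\<Union>?I) \<subseteq> layer_span D UNIV"
    by (intro vec.span_minimal subspace_layer_span) blast
qed

text \<open>The dual support has no gaps, so endpoint plus diameter is the top dual index; this
  rewrites the displacement.\<close>

lemma irreducible_Min_plus_diameter:
  assumes irr: "irreducible_pair_module A As W"
  shows "Min (supps W) + (card (supps W) - 1) = Max (supps W)"
proof -
  have W: "vec.subspace W" "W \<noteq> {0}"
    using irr by (auto simp: irreducible_pair_module_def pair_module_def)
  have "card (supps W) = Suc (Max (supps W)) - Min (supps W)"
    using Q.irreducible_support_interval[OF irr[unfolded irreducible_pair_module_commute[of A]]]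
    by (metis card_atLeastAtMost)
  moreover have "Min (supps W) \<le> Max (supps W)"
    using Q.finite_module_support Q.module_support_nonempty[OF W] by (simp add: Max_ge_iff)
  ultimately show ?thesis by linarith
qed

lemma layer_UNIV_eq:
  assumes "i \<le> D"
  shows "layer D UNIV i = (\<Sum>j\<le>i. range ((*v) (Es j))) \<inter> (\<Sum>j\<le>D - i. range ((*v) (E j)))"
proof -
  have *: "(\<Sum>j\<le>m. range ((*v) (F j))) = {w. \<forall>j\<le>D. m < j \<longrightarrow> F j *v w = 0}"
    if m: "m \<le> D" and F: "\<And>v. (\<Sum>i\<le>D. F i *v v) = v"
      "\<And>i j v. i \<le> D \<Longrightarrow> j \<le> D \<Longrightarrow> F i *v (F j *v v) = (if i = j then F j *v v else 0)"
    for m and F :: "nat \<Rightarrow> complex^'n^'n"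
  proof -
    have "F j *v (\<Sum>k\<le>m. f k) = 0"
      if j: "j \<le> D" "m < j" and f: "\<And>k. k \<le> m \<Longrightarrow> f k \<in> range ((*v) (F k))" for j f
      unfolding matrix_vector_mult_sum
    proof (intro sum.neutral ballI)
      fix k assume "k \<in> {..m}"
      moreover from this obtain v where "f k = F k *v v"
        using f by auto
      ultimately show "F j *v f k = 0"
        using j m F(2)[of j k v] by auto
    qed
    moreover have "w = (\<Sum>k\<le>m. F k *v w)" if "\<And>j. j \<le> D \<Longrightarrow> m < j \<Longrightarrow> F j *v w = 0" for w
    proof -
      have "w = (\<Sum>i\<le>D. F i *v w)" by (simp add: F)
      also have "\<dots> = (\<Sum>k\<le>m. F k *v w)"
        using that m by (intro sum.mono_neutral_right) auto
      finally show ?thesis .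
    qed
    ultimately show ?thesis
      unfolding set_sum_alt[OF finite_atMost] by fast
  qed
  have "(\<Sum>j\<le>i. range ((*v) (Es j))) = {w. \<forall>j\<le>D. i < j \<longrightarrow> Es j *v w = 0}"
    by (rule *) (auto simp: assms Q.sum_E Q.E_E)
  moreover have "(\<Sum>j\<le>D - i. range ((*v) (E j))) = {w. \<forall>j\<le>D. D - i < j \<longrightarrow> E j *v w = 0}"
    by (rule *) (auto simp: P.sum_E P.E_E)
  moreover have "D < i + j \<longleftrightarrow> D - i < j" for j
    using assms by linarith
  ultimately show ?thesis
    unfolding layer_def by blast
qed

lemma sum_layer_UNIV: "(\<Sum>i\<le>D. layer D UNIV i) = layer_span D UNIV"
proof -
  \<comment> \<open>For \<open>i > D\<close> the condition \<open>D < i + j\<close> holds for every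
    \<open>j\<close>, so the layer is zero and the indices up to \<open>D\<close> suffice.\<close>
  have "layer D UNIV i \<subseteq> layer D UNIV 0" if "D < i" for i
  proof
    fix w assume "w \<in> layer D UNIV i"
    then have "E j *v w = 0" if "j \<le> D" for j
      using that \<open>D < i\<close> by (auto simp: layer_def)
    then have "w = 0"
      by (rule P.E_zero_imp_zero)
    then show "w \<in> layer D UNIV 0" by (simp add: layer_def)
  qed
  then have "(\<Union>i. layer D UNIV i) = (\<Union>i\<le>D. layer D UNIV i)"
    by (intro equalityI UN_least) (metis UN_upper atMost_iff le0 not_le order_trans, blast)
  then show ?thesis
    by (simp add: layer_span_def set_sum_eq_span_Union subspace_layer)
qed

end

section \<open>Self-adjoint matrices\<close>

text \<open>Variational argument: a maximiser \<open>v\<close> of the Rayleigh quotient on the unit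
  sphere of \<open>S\<close> is an eigenvector, because moving it along the residual
  \<open>z\<close> would otherwise increase the quotient.\<close>

lemma selfadjoint_eigenvector_exists:
  fixes A :: "complex^'n^'n"
  assumes sa: "selfadjoint A" and S: "vec.subspace S" and inv: "invariant A S" and nz: "S \<noteq> {0}"
  obtains v c where "v \<in> S" "v \<noteq> 0" "A *v v = of_real c *s v"
proof -
  note S' = vec_subspace_imp_subspace[OF S]
  note scale = linear_scale[OF linear_matrix_vector_mult[of A]]
  obtain u0 where u0: "u0 \<in> S" "u0 \<noteq> 0"
    using nz vec.subspace_0[OF S] by blast
  let ?K = "S \<inter> sphere 0 1"
  have "compact ?K"
    using closed_subspace[OF S'] by (intro closed_Int_compact) auto
  moreover have "(1 / norm u0) *\<^sub>R u0 \<in> ?K"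
    using u0 S' by (auto simp: subspace_mul)
  moreover have "continuous_on ?K (\<lambda>v. inner (A *v v) v)"
    by (intro continuous_intros linear_continuous_on linear_conv_bounded_linear[THEN iffD1]
        linear_matrix_vector_mult)
  ultimately obtain v where v: "v \<in> ?K" and max: "\<And>u. u \<in> ?K \<Longrightarrow> inner (A *v u) u \<le> inner (A *v v) v"
    using continuous_attains_sup[of ?K "\<lambda>v. inner (A *v v) v"] by blast
  define c where "c = inner (A *v v) v"
  define g where "g u = c * inner u u - inner (A *v u) u" for u
  \<comment> \<open>On unit vectors this is maximality of \<open>c\<close>; \<open>g\<close> is
    quadratic, so scaling gives the rest.\<close>
  have g: "g u \<ge> 0" if u: "u \<in> S" for u
  proof (cases "u = 0")
    case False
    let ?u = "(1 / norm u) *\<^sub>R u"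
    have "?u \<in> ?K"
      using u False S' by (auto simp: subspace_mul)
    from max[OF this] have "(1 / norm u)\<^sup>2 * inner (A *v u) u \<le> c"
      by (simp add: scale c_def power2_eq_square)
    then have "inner (A *v u) u \<le> c * (norm u)\<^sup>2"
      using False by (simp add: field_simps)
    then show ?thesis by (simp add: g_def power2_norm_eq_inner)
  qed (simp add: g_def)
  define z where "z = A *v v - c *\<^sub>R v"
  have z: "z \<in> S"
    using v inv S' by (auto simp: z_def invariant_def intro!: subspace_diff subspace_mul)
  have norm_v: "inner v v = 1"
    using v by (simp add: norm_eq_1)
  have gt: "g (v + t *\<^sub>R z) = t\<^sup>2 * g z - 2 * t * inner z z" for t
  proof -
    have "inner (A *v z) v = inner z (A *v v)"
      using selfadjointD[OF sa] .
    moreover have "inner z (A *v v) = inner z z + c * inner z v"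
      by (subst (2) z_def) (simp add: inner_diff_right)
    moreover have "inner (A *v v) z = inner z (A *v v)" "inner v z = inner z v"
      by (simp_all add: inner_commute)
    ultimately show ?thesis
      using norm_v unfolding g_def
      by (simp add: matrix_vector_right_distrib scale inner_add_left inner_add_right c_def[symmetric]
          power2_eq_square algebra_simps)
  qed
  let ?b = "inner z z" and ?c = "g z"
  have c: "?c \<ge> 0" using g z by blast
  \<comment> \<open>This step length makes the quadratic in \<open>gt\<close> negative unless
    \<open>?b\<close> is zero; the added 1 keeps the denominator positive when \<open>g z\<close> is
    zero.\<close>
  have "v + (?b / (?c + 1)) *\<^sub>R z \<in> S"
    using v z S' by (auto intro!: subspace_add subspace_mul)
  from g[OF this] have "0 \<le> (?b / (?c + 1))\<^sup>2 * ?c - 2 * (?b / (?c + 1)) * ?b"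
    by (simp add: gt)
  also have "\<dots> = - (?b\<^sup>2 * (?c + 2) / (?c + 1)\<^sup>2)"
    using c by (simp add: divide_simps) (simp add: algebra_simps power2_eq_square)
  finally have "?b\<^sup>2 * (?c + 2) / (?c + 1)\<^sup>2 \<le> 0"
    by simp
  moreover have "?b\<^sup>2 * (?c + 2) / (?c + 1)\<^sup>2 > 0" if "?b \<noteq> 0"
    using c that by (intro divide_pos_pos mult_pos_pos) auto
  ultimately have "z = 0" by fastforce
  then have "A *v v = of_real c *s v"
    by (simp add: z_def scaleR_eq_of_real_smult)
  moreover have "v \<in> S" "v \<noteq> 0"
    using v by auto
  ultimately show ?thesis
    using that by blast
qed

lemma eigenspace_subspace: "vec.subspace (eigenspace A c)"
  by (auto simp: eigenspace_def vec.subspace_def matrix_vector_right_distrib vector_scalar_commute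
      vec.scale_right_distrib mult.commute)

lemma eigenspace_invariant: "invariant A (eigenspace A c)"
  by (auto simp: eigenspace_def invariant_def vector_scalar_commute)

text \<open>The orthogonal complement of the span is invariant; were it nonzero, it would contain an
  eigenvector with real eigenvalue, which already lies in the span.\<close>

lemma selfadjoint_span_eigenspaces:
  fixes A :: "complex^'n^'n"
  assumes sa: "selfadjoint A"
  shows "vec.span (\<Union>c :: real. eigenspace A (of_real c)) = UNIV" (is "?U = _")
proof -
  have "invariant A ?U"
    using eigenspace_invariant[of A] by (intro invariant_span vec.span_base) (auto simp: invariant_def)
  note inv = invariant_orthogonal_comp[OF sa this]
  have "?U\<^sup>\<bottom> = {0}"
  proof (rule ccontr)
    assume "?U\<^sup>\<bottom> \<noteq> {0}"
    then obtain v c where v: "v \<in> ?U\<^sup>\<bottom>" "v \<noteq> 0" "A *v v = of_real c *s v"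
      using selfadjoint_eigenvector_exists[OF sa _ inv] vec_subspace_orthogonal_comp[OF vec.subspace_span]
      by blast
    then have "v \<in> ?U"
      by (intro vec.span_base) (auto simp: eigenspace_def)
    with v show False
      using orthogonal_comp_Int_zero by blast
  qed
  then show ?thesis
    by (metis orthogonal_comp_null orthogonal_comp_self vec.subspace_span vec_subspace_imp_subspace)
qed

lemma inner_smult_self: "inner (c *s v) v = Re c * inner v (v :: complex^'n)"
  by (simp add: inner_vec_def inner_complex_def sum_distrib_left algebra_simps)

lemma selfadjoint_eigenvalue_real:
  fixes A :: "complex^'n^'n"
  assumes sa: "selfadjoint A" and v: "A *v v = c *s v" "v \<noteq> 0"
  shows "c = of_real (Re c)"
proof -
  \<comment> \<open>\<open>inner\<close> is real valued; pairing with \<open>\<i> *s v\<close>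
    exposes the imaginary part of the eigenvalue.\<close>
  have "inner (A *v v) (\<i> *s v) = inner v (A *v (\<i> *s v))"
    using selfadjointD[OF sa] .
  then have "Im c * inner v v = - Im c * inner v v"
    by (simp add: v(1) vector_scalar_commute inner_smult_right inner_smult_self)
  with v(2) show ?thesis
    by (simp add: complex_eq_iff)
qed

lemma eigenspaces_orthogonal:
  assumes sa: "selfadjoint A" and uv: "u \<in> eigenspace A a" "v \<in> eigenspace A b" and ab: "a \<noteq> b"
  shows "inner u v = 0"
proof (cases "u = 0 \<or> v = 0")
  case False
  then have real: "a = of_real (Re a)" "b = of_real (Re b)"
    using selfadjoint_eigenvalue_real[OF sa] uv by (auto simp: eigenspace_def)
  have "inner (A *v u) v = inner u (A *v v)"
    using selfadjointD[OF sa] .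
  then have "inner (Re a *\<^sub>R u) v = inner u (Re b *\<^sub>R v)"
    using uv real by (simp add: eigenspace_def scaleR_eq_of_real_smult)
  with ab real show ?thesis by auto
qed auto

lemma eigenspace_index_unique:
  "v \<in> eigenspace A a \<Longrightarrow> v \<in> eigenspace A b \<Longrightarrow> v \<noteq> 0 \<Longrightarrow> a = b"
  by (auto simp: eigenspace_def)

text \<open>The orthogonal projection qualifies because the other eigenspaces are orthogonal. It
  ensures that each eigenvalue is represented in an ordering of the idempotents.\<close>

lemma primitive_idempotent_exists:
  assumes sa: "selfadjoint A" and ne: "eigenspace A c \<noteq> {0}"
  obtains F where "primitive_idempotent A F" "\<And>v. v \<in> eigenspace A c \<Longrightarrow> F *v v = v"
proof -
  obtain F where F: "\<And>v. F *v v \<in> eigenspace A c" "\<And>v. v \<in> eigenspace A c \<Longrightarrow> F *v v = v"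
    "\<And>v. v \<in> (eigenspace A c)\<^sup>\<bottom> \<Longrightarrow> F *v v = 0"
    by (rule orthogonal_projection_exists[OF eigenspace_subspace]) blast
  have "v \<in> (eigenspace A c)\<^sup>\<bottom>" if "v \<in> eigenspace A b" "b \<noteq> c" for v b
    using eigenspaces_orthogonal[OF sa _ that(1)] that(2)
    by (auto simp: orthogonal_comp_def orthogonal_def)
  moreover have "range ((*v) F) = eigenspace A c"
    using F(1,2) by (auto simp: image_iff) metis
  ultimately have "primitive_idempotent A F"
    unfolding primitive_idempotent_def using F ne by blast
  with F that show ?thesis by blast
qed

lemma matrix_eq_on_span:
  fixes M N :: "complex^'n^'m"
  assumes "\<And>v. v \<in> S \<Longrightarrow> M *v v = N *v v" "v \<in> vec.span S"
  shows "M *v v = N *v v"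
  using assms(2)
  by (induction rule: vec.span_induct_alt)
    (auto simp: matrix_vector_right_distrib vector_scalar_commute assms(1))

text \<open>Two idempotents with the same eigenvalue agree on all eigenvectors, hence are equal, so
  injectivity of the ordering makes the eigenvalues distinct.\<close>

lemma primitive_idempotents_eigenvalues:
  fixes A :: "complex^'n^'n"
  assumes sa: "selfadjoint A" and bij: "bij_betw E {..D::nat} {F. primitive_idempotent A F}"
  obtains \<theta> :: "nat \<Rightarrow> real" where "inj_on \<theta> {..D}"
    "\<And>i v. i \<le> D \<Longrightarrow> E i *v v \<in> eigenspace A (of_real (\<theta> i))"
    "\<And>i j v. i \<le> D \<Longrightarrow> j \<le> D \<Longrightarrow> E i *v (E j *v v) = (if i = j then E j *v v else 0)"
    "\<And>v. (\<Sum>i\<le>D. E i *v v) = v"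
proof -
  have "primitive_idempotent A (E i)" if "i \<le> D" for i
    using bij that by (auto simp: bij_betw_def)
  then have "\<forall>i\<in>{..D}. primitive_idempotent A (E i)" by simp
  then obtain \<mu> where "\<forall>i\<in>{..D}. eigenspace A (\<mu> i) \<noteq> {0} \<and>
      range ((*v) (E i)) = eigenspace A (\<mu> i) \<and> (\<forall>v\<in>eigenspace A (\<mu> i). E i *v v = v) \<and>
      (\<forall>c. c \<noteq> \<mu> i \<longrightarrow> (\<forall>v\<in>eigenspace A c. E i *v v = 0))"
    unfolding primitive_idempotent_def bchoice_iff by blast
  then have \<mu>: "\<And>i. i \<le> D \<Longrightarrow> eigenspace A (\<mu> i) \<noteq> {0}"
    "\<And>i. i \<le> D \<Longrightarrow> range ((*v) (E i)) = eigenspace A (\<mu> i)"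
    "\<And>i v. i \<le> D \<Longrightarrow> v \<in> eigenspace A (\<mu> i) \<Longrightarrow> E i *v v = v"
    "\<And>i c v. i \<le> D \<Longrightarrow> c \<noteq> \<mu> i \<Longrightarrow> v \<in> eigenspace A c \<Longrightarrow> E i *v v = 0"
    by blast+
  have eig: "E i *v v \<in> eigenspace A (\<mu> i)" if "i \<le> D" for i v
    using \<mu>(2)[OF that] by blast
  have nonzero: "\<exists>v\<in>eigenspace A (\<mu> i). v \<noteq> 0" if "i \<le> D" for i
    using \<mu>(1)[OF that] vec.subspace_0[OF eigenspace_subspace[of A "\<mu> i"]] by blast
  have real: "\<mu> i = of_real (Re (\<mu> i))" if "i \<le> D" for i
    using nonzero[OF that] selfadjoint_eigenvalue_real[OF sa] by (auto simp: eigenspace_def)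
  have "i = j" if ij: "i \<le> D" "j \<le> D" "\<mu> i = \<mu> j" for i j
  proof -
    have "E i *v v = E j *v v" if "v \<in> (\<Union>c :: real. eigenspace A (of_real c))" for v
      using that ij \<mu>(3,4) by (metis UN_E)
    then have "E i *v v = E j *v v" for v
      using matrix_eq_on_span[of "\<Union>c :: real. eigenspace A (of_real c)" "E i" "E j" v]
      by (simp add: selfadjoint_span_eigenspaces[OF sa])
    then have "E i = E j"
      by (simp add: matrix_eq)
    with bij ij show ?thesis
      by (auto simp: bij_betw_def inj_on_def)
  qed
  note inj = this
  have E_E: "E i *v (E j *v v) = (if i = j then E j *v v else 0)" if "i \<le> D" "j \<le> D" for i j v
    using that eig[of j v] \<mu>(3,4) inj by metis
  \<comment> \<open>Checked on eigenvectors: surjectivity of the ordering supplies the idempotent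
    \<open>E k\<close> that fixes \<open>v\<close>, and all others kill it.\<close>
  have "(\<Sum>i\<le>D. E i) *v v = mat 1 *v v" for v
  proof (rule matrix_eq_on_span)
    show "v \<in> vec.span (\<Union>c :: real. eigenspace A (of_real c))"
      by (simp add: selfadjoint_span_eigenspaces[OF sa])
    fix v assume "v \<in> (\<Union>c :: real. eigenspace A (of_real c))"
    then obtain c :: real where c: "v \<in> eigenspace A (of_real c)" by blast
    show "(\<Sum>i\<le>D. E i) *v v = mat 1 *v v"
    proof (cases "v = 0")
      case False
      then have "eigenspace A (of_real c) \<noteq> {0}" using c by auto
      then obtain F where F: "primitive_idempotent A F" "F *v v = v"
        using primitive_idempotent_exists[OF sa] c by metis
      then obtain k where k: "k \<le> D" "F = E k"
        using bij by (auto simp: bij_betw_def)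
      then have "v \<in> eigenspace A (\<mu> k)"
        using F(2) eig by metis
      then have ck: "of_real c = \<mu> k"
        using eigenspace_index_unique c False by blast
      have "E i *v v = 0" if "i \<le> D" "i \<noteq> k" for i
        using \<mu>(4)[OF that(1) _ c] ck inj[OF that(1) k(1)] that by metis
      then have "(\<Sum>i\<le>D. E i *v v) = (\<Sum>i\<le>D. if i = k then v else 0)"
        using F k by (intro sum.cong) auto
      then show ?thesis
        using k by (simp add: sum_matrix_vector_mult)
    qed simp
  qed
  then have "(\<Sum>i\<le>D. E i *v v) = v" for v
    by (simp add: sum_matrix_vector_mult)
  moreover have "inj_on (\<lambda>i. Re (\<mu> i)) {..D}"
  proof (rule inj_onI)
    fix i j assume ij: "i \<in> {..D}" "j \<in> {..D}" "Re (\<mu> i) = Re (\<mu> j)"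
    then have "\<mu> i = \<mu> j"
      using real[of i] real[of j] by simp
    with ij inj show "i = j" by simp
  qed
  moreover have "E i *v v \<in> eigenspace A (of_real (Re (\<mu> i)))" if "i \<le> D" for i v
    using eig[OF that] by (simp only: real[OF that, symmetric])
  ultimately show ?thesis
    using E_E by - (rule that[of "\<lambda>i. Re (\<mu> i)"]; assumption)
qed

section \<open>Three-term recurrences\<close>

text \<open>Common form of the recurrence for the distance matrices, with intersection numbers as
  coefficients, and for their duals, with Krein parameters.\<close>

locale three_term_recurrence =
  fixes D :: nat and B :: "complex^'n^'n" and M :: "nat \<Rightarrow> complex^'n^'n" and c :: "nat \<Rightarrow> nat \<Rightarrow> complex"
  assumes rec: "j \<le> D \<Longrightarrow> B ** M j = (\<Sum>h\<le>D. matrix_scale (c h j) (M h))"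
    and far: "h \<le> D \<Longrightarrow> j \<le> D \<Longrightarrow> h > Suc j \<or> j > Suc h \<Longrightarrow> c h j = 0"
    and up: "j < D \<Longrightarrow> c (Suc j) j \<noteq> 0"
    and down: "j < D \<Longrightarrow> c j (Suc j) \<noteq> 0"
    and init: "M 0 = mat 1"
begin

text \<open>The nonzero upper coefficient allows solving the recurrence for the next matrix, so each
  \<open>M j\<close> is a polynomial in \<open>B\<close>.\<close>

lemma mem_subalgebra:
  assumes R: "matrix_subalgebra R" and B: "B \<in> R"
  shows "j \<le> D \<Longrightarrow> M j \<in> R"
proof (induction j rule: less_induct)
  case (less j)
  have add: "X + Y \<in> R" and scale: "matrix_scale a X \<in> R" and mult: "X ** Y \<in> R" and one: "mat 1 \<in> R"
    if "X \<in> R" "Y \<in> R" for X Y a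
    using R that by (auto simp: matrix_subalgebra_def)
  show ?case
  proof (cases j)
    case 0
    then show ?thesis using B by (simp add: init one)
  next
    case (Suc k)
    let ?s = "\<Sum>h\<in>{..D} - {j}. matrix_scale (c h k) (M h)"
    have zero: "0 \<in> R"
      using scale[OF B B, of 0] by (simp add: matrix_scale_def zero_vec_def)
    \<comment> \<open>Indices above \<open>j = Suc k\<close> have coefficient zero, so only matrices
      covered by the induction hypothesis contribute.\<close>
    have summand: "matrix_scale (c h k) (M h) \<in> R" if h: "h \<in> {..D} - {j}" for h
    proof (cases "h < j")
      case True
      then show ?thesis
        using less.IH[of h] h scale by auto
    next
      case False
      then have "c h k = 0"
        using h Suc less.prems by (intro far) auto
      then show ?thesis using zero by (simp add: matrix_scale_def zero_vec_def)
    qed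
    have "(\<Sum>h\<in>I. matrix_scale (c h k) (M h)) \<in> R" if "finite I" "I \<subseteq> {..D} - {j}" for I
      using that by (induction I rule: finite_induct) (auto intro: add zero summand)
    then have "?s \<in> R" by simp
    moreover have "B ** M k \<in> R"
      using less Suc B by (intro mult) auto
    ultimately have "matrix_scale (inverse (c j k)) (B ** M k + matrix_scale (- 1) ?s) \<in> R"
      using add scale by blast
    moreover have "B ** M k = matrix_scale (c j k) (M j) + ?s"
      using rec[of k] less.prems Suc by (simp add: sum.remove[of "{..D}" j])
    moreover have "matrix_scale (inverse a) (matrix_scale a X + Y + matrix_scale (- 1) Y) = X"
      if "a \<noteq> 0" for a and X Y :: "complex^'n^'n"
      using that by (simp add: matrix_scale_def vec_eq_iff)
    ultimately show ?thesis
      using up[of k] less.prems Suc by simp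
  qed
qed

text \<open>Run the recurrence downwards: once all \<open>M h\<close> with \<open>h > j\<close> kill
  \<open>v\<close>, the recurrence at \<open>Suc j\<close> leaves only a nonzero multiple of
  \<open>M j *v v\<close>. At index 0 this gives \<open>v\<close> itself.\<close>

lemma injective_M:
  assumes v: "M D *v v = 0"
  shows "v = 0"
proof -
  have "\<forall>h. j \<le> h \<longrightarrow> h \<le> D \<longrightarrow> M h *v v = 0" if "j \<le> D" for j
    using that
  proof (induction rule: inc_induct)
    case base
    then show ?case using v by (auto dest: le_antisym)
  next
    case (step j)
    have "B *v (M (Suc j) *v v) = (B ** M (Suc j)) *v v"
      by (simp only: matrix_vector_mul_assoc)
    also have "\<dots> = (\<Sum>h\<le>D. c h (Suc j) *s (M h *v v))"
      using rec[of "Suc j"] step by (simp only: sum_matrix_vector_mult matrix_scale_vector_mult Suc_leI)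
    finally have "B *v (M (Suc j) *v v) = (\<Sum>h\<le>D. c h (Suc j) *s (M h *v v))" .
    then have "0 = (\<Sum>h\<le>D. c h (Suc j) *s (M h *v v))"
      using step by simp
    also have "\<dots> = (\<Sum>h\<le>D. if h = j then c j (Suc j) *s (M j *v v) else 0)"
    proof (intro sum.cong refl)
      fix h assume h: "h \<in> {..D}"
      consider "h < j" | "h = j" | "Suc j \<le> h" by linarith
      then show "c h (Suc j) *s (M h *v v) = (if h = j then c j (Suc j) *s (M j *v v) else 0)"
        using h step far[of h "Suc j"] by cases auto
    qed
    finally have "M j *v v = 0"
      using down[of j] step by simp
    then show ?case
      using step.IH by (metis Suc_leI le_neq_implies_less)
  qed
  from this[of 0] have "M 0 *v v = 0" by blast
  then show ?thesis
    by (simp add: init)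
qed

end

section \<open>Distance-regular graphs and their Bose-Mesner algebra\<close>

locale distance_regular_graph =
  fixes adj :: "'v::finite \<Rightarrow> 'v \<Rightarrow> bool" and D :: nat
  assumes D_def: "D = graph_diameter adj" and D_ge_1: "D \<ge> 1" and drg: "distance_regular adj"
begin

abbreviation dist :: "'v \<Rightarrow> 'v \<Rightarrow> nat" where
  "dist \<equiv> graph_dist adj"

lemma adj_sym: "adj y z \<Longrightarrow> adj z y"
  using drg by (auto simp: distance_regular_def simple_graph_def symp_def)

lemma adj_irrefl: "\<not> adj y y"
  using drg by (auto simp: distance_regular_def simple_graph_def irreflp_def)

lemma relpowp_dist: "(adj ^^ dist y z) y z"
proof -
  have "adj\<^sup>*\<^sup>* y z"
    using drg by (simp add: distance_regular_def connected_graph_def)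
  then have "\<exists>n. (adj ^^ n) y z"
    by (simp add: rtranclp_power)
  then show ?thesis
    unfolding graph_dist_def by (rule LeastI_ex)
qed

lemma dist_le: "(adj ^^ n) y z \<Longrightarrow> dist y z \<le> n"
  unfolding graph_dist_def by (rule Least_le)

lemma dist_triangle: "dist y z \<le> dist y w + dist w z"
  by (rule dist_le) (rule relpowp_trans[OF relpowp_dist relpowp_dist])

lemma dist_eq_0 [simp]: "dist y z = 0 \<longleftrightarrow> y = z"
  using relpowp_dist[of y z] dist_le[of 0 y z] by auto

lemma dist_self [simp]: "dist y y = 0"
  by simp

lemma dist_sym: "dist y z = dist z y"
proof -
  have "(adj ^^ n) z y" if "(adj ^^ n) y z" for n y z
    using that
  proof (induction n arbitrary: z)
    case (Suc n)
    obtain w where "(adj ^^ n) y w" "adj w z"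
      using Suc.prems by (rule relpowp_Suc_E)
    then have "adj z w" "(adj ^^ n) w y"
      using Suc.IH adj_sym by blast+
    then show ?case
      by (rule relpowp_Suc_I2)
  qed auto
  then show ?thesis
    using dist_le relpowp_dist by (meson le_antisym)
qed

lemma dist_eq_1: "dist y z = 1 \<longleftrightarrow> adj y z"
proof
  assume "adj y z"
  then have "dist y z \<le> 1" "dist y z \<noteq> 0"
    using dist_le[of 1 y z] adj_irrefl by auto
  then show "dist y z = 1" by linarith
qed (use relpowp_dist[of y z] in auto)

lemma dist_SucE:
  assumes "dist y z = Suc n"
  obtains w where "dist y w = 1" "dist w z = n"
proof -
  obtain w where w: "adj y w" "(adj ^^ n) w z"
    using relpowp_dist[of y z] unfolding assms by (rule relpowp_Suc_E2)
  moreover have "dist w z \<le> n" "Suc n \<le> 1 + dist w z"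
    using dist_le[OF w(2)] dist_triangle[of y z w] assms w(1) by (auto simp flip: dist_eq_1)
  ultimately show ?thesis
    using that[of w] by (simp add: dist_eq_1 del: One_nat_def)
qed

lemma dist_le_D: "dist y z \<le> D"
proof -
  have "{dist y z |y z. True} = (\<lambda>(y, z). dist y z) ` UNIV" by auto
  then have "finite {dist y z |y z. True}" by simp
  then show ?thesis
    unfolding D_def graph_diameter_def by (rule Max_ge) auto
qed

lemma dist_attained:
  assumes "i \<le> D"
  obtains y z where "dist y z = i"
proof -
  have "\<exists>y z. dist y z = i"
    using assms
  proof (induction rule: inc_induct)
    case base
    have "{dist y z |y z. True} = (\<lambda>(y, z). dist y z) ` UNIV" by auto
    then have "finite {dist y z |y z. True}" by simp
    then have "Max {dist y z |y z. True} \<in> {dist y z |y z. True}"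
      by (rule Max_in) auto
    then show ?case
      unfolding D_def graph_diameter_def by fastforce
  next
    case (step n)
    then show ?case by (meson dist_SucE)
  qed
  with that show ?thesis by blast
qed

section \<open>Intersection numbers and distance matrices\<close>

definition p :: "nat \<Rightarrow> nat \<Rightarrow> nat \<Rightarrow> nat" where
  "p h i j = (SOME q. \<forall>y z. dist y z = h \<longrightarrow> card {w. dist y w = i \<and> dist z w = j} = q)"

lemma card_eq_p:
  assumes "i \<le> D" "j \<le> D"
  shows "card {w. dist y w = i \<and> dist z w = j} = p (dist y z) i j"
proof -
  have "\<exists>q. \<forall>y' z'. dist y' z' = dist y z \<longrightarrow> card {w. dist y' w = i \<and> dist z' w = j} = q"
    using drg assms dist_le_D[of y z] unfolding distance_regular_def D_def by blast
  from someI_ex[OF this] show ?thesis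
    unfolding p_def by blast
qed

lemma p_pos:
  assumes "i \<le> D" "j \<le> D" "dist y w = i" "dist z w = j"
  shows "p (dist y z) i j \<noteq> 0"
  using card_eq_p[OF assms(1,2), of y z] assms(3,4) by (metis (mono_tags, lifting) card_0_eq empty_iff finite mem_Collect_eq)

text \<open>The number of vertices at distance \<open>i\<close> from a vertex is
  \<open>p 0 i i\<close> at every vertex, and it is nonzero at one.\<close>

lemma dist_attained_from:
  assumes "i \<le> D"
  obtains z where "dist y z = i"
proof -
  obtain u v where "dist u v = i"
    using assms dist_attained by blast
  then have "p 0 i i \<noteq> 0"
    using p_pos[of i i u v u] assms by simp
  then have "{w. dist y w = i \<and> dist y w = i} \<noteq> {}"
    using card_eq_p[of i i y y] assms by (metis card.empty dist_eq_0)
  with that show ?thesis by auto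
qed

definition dmat :: "nat \<Rightarrow> complex^'v^'v" where
  "dmat j = (\<chi> y z. if dist y z = j then 1 else 0)"

abbreviation A :: "complex^'v^'v" where
  "A \<equiv> adjacency_matrix adj"

lemma A_eq_dmat: "A = dmat 1"
  by (simp add: adjacency_matrix_def dmat_def dist_eq_1 del: One_nat_def)

lemma A_dmat_entry:
  assumes "j \<le> D"
  shows "(A ** dmat j) $ y $ z = of_nat (p (dist y z) 1 j)"
proof -
  have "(A ** dmat j) $ y $ z = (\<Sum>w\<in>UNIV. if dist y w = 1 \<and> dist z w = j then 1 else 0)"
    unfolding A_eq_dmat matrix_matrix_mult_def
    by (auto simp: dmat_def dist_sym intro!: sum.cong)
  also have "\<dots> = of_nat (card {w. dist y w = 1 \<and> dist z w = j})"
    by (simp flip: sum.inter_filter)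
  finally show ?thesis
    using card_eq_p[OF D_ge_1 assms] by simp
qed

lemma sum_dist_delta: "(\<Sum>h\<le>D. f h * (if dist y z = h then 1 else 0)) = (f (dist y z) :: 'a::semiring_1)"
  using dist_le_D[of y z] by (simp add: if_distrib cong: if_cong)

text \<open>The triangle inequality makes far coefficients vanish. The neighbouring ones are nonzero
  because a shortest path of length \<open>Suc j\<close> starts with a step to a vertex at distance
  \<open>j\<close> from its end.\<close>

sublocale dmat: three_term_recurrence D A dmat "\<lambda>h j. of_nat (p h 1 j)"
proof
  fix h j :: nat
  show "A ** dmat j = (\<Sum>h\<le>D. matrix_scale (of_nat (p h 1 j)) (dmat h))" if "j \<le> D"
    using sum_dist_delta[where f = "\<lambda>h. complex_of_nat (p h 1 j)"]
    by (simp add: vec_eq_iff A_dmat_entry[OF that] del: One_nat_def)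
      (simp add: matrix_scale_def dmat_def del: One_nat_def)
  show "of_nat (p h 1 j) = (0::complex)" if hj: "h \<le> D" "j \<le> D" "h > Suc j \<or> j > Suc h"
  proof -
    obtain y z where yz: "dist y z = h"
      using dist_attained[OF hj(1)] .
    have "\<not> (dist y w = 1 \<and> dist z w = j)" for w
      using dist_triangle[of y z w] dist_triangle[of z w y] dist_sym[of w z] dist_sym[of z y] yz hj(3) by auto
    then have "{w. dist y w = 1 \<and> dist z w = j} = {}" by blast
    then have "p h 1 j = 0"
      using card_eq_p[OF D_ge_1 hj(2), of y z] yz by (metis card.empty)
    then show ?thesis by simp
  qed
  assume j: "j < D"
  obtain y z where yz: "dist y z = Suc j"
    using dist_attained[of "Suc j"] j by auto
  obtain w where w: "dist y w = 1" "dist w z = j"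
    using dist_SucE[OF yz] .
  show "of_nat (p (Suc j) 1 j) \<noteq> (0::complex)"
    using p_pos[of 1 j y w z] w yz j D_ge_1 dist_sym[of z w] by simp
  show "of_nat (p j 1 (Suc j)) \<noteq> (0::complex)"
    using p_pos[of 1 "Suc j" w y z] w yz j D_ge_1 dist_sym[of z y] dist_sym[of w y] by simp
next
  show "dmat 0 = mat 1"
    by (simp add: dmat_def mat_def)
qed

text \<open>The real form of the Bose-Mesner algebra; membership of the \<open>E i\<close> will show
  that they are real and symmetric.\<close>

definition real_distance_matrices :: "(complex^'v^'v) set" where
  "real_distance_matrices = {M. \<exists>f. \<forall>y z. M $ y $ z = of_real (f (dist y z))}"

lemma subspace_real_distance_matrices: "subspace real_distance_matrices"
proof (rule subspaceI)
  show "0 \<in> real_distance_matrices"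
    unfolding real_distance_matrices_def by (auto intro!: exI[of _ "\<lambda>_. 0"])
  show "M + N \<in> real_distance_matrices" if MN: "M \<in> real_distance_matrices" "N \<in> real_distance_matrices" for M N
  proof -
    obtain f g where "\<forall>y z. M $ y $ z = of_real (f (dist y z))" "\<forall>y z. N $ y $ z = of_real (g (dist y z))"
      using MN by (auto simp: real_distance_matrices_def)
    then show ?thesis
      unfolding real_distance_matrices_def by (auto intro!: exI[of _ "\<lambda>i. f i + g i"])
  qed
  show "c *\<^sub>R M \<in> real_distance_matrices" if M: "M \<in> real_distance_matrices" for c M
  proof -
    obtain f where "\<forall>y z. M $ y $ z = of_real (f (dist y z))"
      using M by (auto simp: real_distance_matrices_def)
    then show ?thesis
      unfolding real_distance_matrices_def
      by (auto intro!: exI[of _ "\<lambda>i. c * f i"] simp: scaleR_conv_of_real[where 'a = complex])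
  qed
qed

lemma A_mult_real_distance_matrix:
  assumes "M \<in> real_distance_matrices"
  shows "A ** M \<in> real_distance_matrices"
proof -
  obtain f where f: "\<And>y z. M $ y $ z = of_real (f (dist y z))"
    using assms by (auto simp: real_distance_matrices_def)
  have "(A ** M) $ y $ z = of_real (\<Sum>j\<le>D. f j * of_nat (p (dist y z) 1 j))" for y z
  proof -
    have "(A ** M) $ y $ z = (\<Sum>w\<in>UNIV. A $ y $ w * (\<Sum>j\<le>D. of_real (f j) * dmat j $ w $ z))"
      by (simp add: matrix_matrix_mult_def f dmat_def sum_dist_delta)
    also have "\<dots> = (\<Sum>j\<le>D. of_real (f j) * (A ** dmat j) $ y $ z)"
      unfolding matrix_matrix_mult_def
      by (simp add: sum_distrib_left) (subst sum.swap, simp add: mult_ac)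
    finally show ?thesis
      by (simp add: A_dmat_entry)
  qed
  then show ?thesis
    unfolding real_distance_matrices_def
    by (intro CollectI exI[of _ "\<lambda>d. \<Sum>j\<le>D. f j * of_nat (p d 1 j)"]) blast
qed

lemma selfadjoint_A: "selfadjoint A"
  by (rule selfadjoint_real_symmetric[where m = "\<lambda>y z. if adj y z then 1 else 0"])
    (auto simp: adjacency_matrix_def adj_sym)

end

section \<open>Primitive idempotents and Krein parameters of a Q-polynomial graph\<close>

locale Q_polynomial_graph = distance_regular_graph adj D
  for adj :: "'v::finite \<Rightarrow> 'v \<Rightarrow> bool" and D +
  fixes E :: "nat \<Rightarrow> complex^'v^'v" and \<theta> :: "nat \<Rightarrow> real" and x :: 'v
  assumes E_0: "E 0 = matrix_scale (1 / of_nat CARD('v)) (\<chi> y z. 1)"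
    and Q_poly: "Q_polynomial D E"
    and inj_\<theta>: "inj_on \<theta> {..D}"
    and E_eigenspace: "i \<le> D \<Longrightarrow> E i *v v \<in> eigenspace A (of_real (\<theta> i))"
    and E_E: "i \<le> D \<Longrightarrow> j \<le> D \<Longrightarrow> E i *v (E j *v v) = (if i = j then E j *v v else 0)"
    and sum_E: "(\<Sum>i\<le>D. E i *v v) = v"
begin

text \<open>The identity is a real distance matrix and the sum of the \<open>E i\<close>, which are
  its eigencomponents under left multiplication by \<open>A\<close>; the subspace is stable under
  that map.\<close>

lemma E_distance_matrix:
  assumes i: "i \<le> D"
  shows "E i \<in> real_distance_matrices"
proof (rule eigencomponent_in_subspace[where B = "(**) A" and \<theta> = \<theta> and I = "{..D}"])
  show "linear ((**) A)"
    by (rule linearI) (simp_all add: vec_eq_iff matrix_matrix_mult_def scaleR_sum_right distrib_left sum.distrib)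
  show "A ** E i = \<theta> i *\<^sub>R E i" if "i \<in> {..D}" for i
  proof -
    have "(A ** E i) *v v = (\<theta> i *\<^sub>R E i) *v v" for v
    proof -
      have "(A ** E i) *v v = of_real (\<theta> i) *s (E i *v v)"
        using E_eigenspace[of i v] that by (simp add: eigenspace_def flip: matrix_vector_mul_assoc)
      also have "\<dots> = matrix_scale (of_real (\<theta> i)) (E i) *v v"
        by (simp add: matrix_scale_vector_mult)
      also have "matrix_scale (of_real (\<theta> i)) (E i) = \<theta> i *\<^sub>R E i"
        by (simp add: vec_eq_iff matrix_scale_def scaleR_conv_of_real[where 'a = complex])
      finally show ?thesis .
    qed
    then show ?thesis by (simp add: matrix_eq)
  qed
  have "(\<Sum>i\<le>D. E i) = mat 1"
    by (simp add: matrix_eq sum_matrix_vector_mult sum_E)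
  moreover have "(mat 1 :: complex^'v^'v) \<in> real_distance_matrices"
    by (auto simp: real_distance_matrices_def mat_def intro!: exI[of _ "\<lambda>i. if i = 0 then 1 else 0"])
  ultimately show "(\<Sum>i\<le>D. E i) \<in> real_distance_matrices" by simp
qed (use i inj_\<theta> subspace_real_distance_matrices A_mult_real_distance_matrix in auto)

lemma E_entries:
  assumes "i \<le> D"
  obtains f where "\<And>y z. E i $ y $ z = of_real (f (dist y z))"
  using E_distance_matrix[OF assms] by (auto simp: real_distance_matrices_def)

lemma E_sym: "i \<le> D \<Longrightarrow> E i $ y $ z = E i $ z $ y"
  by (metis E_entries dist_sym)

lemma E_real: "i \<le> D \<Longrightarrow> E i $ y $ z \<in> \<real>"
  by (metis E_entries Reals_of_real)

lemma E_mult_E: "i \<le> D \<Longrightarrow> j \<le> D \<Longrightarrow> E i ** E j = (if i = j then E j else 0)"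
  by (simp add: matrix_eq E_E flip: matrix_vector_mul_assoc)

text \<open>A polynomial in \<open>A\<close> is scalar on each eigenspace of
  \<open>A\<close>.\<close>

lemma dmat_span_E:
  assumes j: "j \<le> D"
  obtains c where "dmat j = (\<Sum>l\<le>D. matrix_scale (c l) (E l))"
proof -
  have "\<exists>c. \<forall>v\<in>eigenspace A (of_real (\<theta> l)). dmat j *v v = c *s v" for l
    using dmat.mem_subalgebra[OF matrix_subalgebra_scalar_on[of "eigenspace A (of_real (\<theta> l))"] _ j]
    by (auto simp: eigenspace_def)
  then obtain c where c: "\<And>l v. v \<in> eigenspace A (of_real (\<theta> l)) \<Longrightarrow> dmat j *v v = c l *s v"
    by metis
  have "dmat j *v v = (\<Sum>l\<le>D. matrix_scale (c l) (E l)) *v v" for v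
  proof -
    have "dmat j *v v = dmat j *v (\<Sum>l\<le>D. E l *v v)"
      by (simp add: sum_E)
    also have "\<dots> = (\<Sum>l\<le>D. matrix_scale (c l) (E l) *v v)"
      unfolding matrix_vector_mult_sum
      by (intro sum.cong refl) (simp add: c[OF E_eigenspace] matrix_scale_vector_mult)
    finally show ?thesis by (simp add: sum_matrix_vector_mult)
  qed
  then have "dmat j = (\<Sum>l\<le>D. matrix_scale (c l) (E l))"
    by (simp add: matrix_eq)
  then show ?thesis by (rule that)
qed

lemma distance_matrix_span_E:
  assumes f: "\<And>y z. M $ y $ z = f (dist y z)"
  obtains c where "M = (\<Sum>l\<le>D. matrix_scale (c l) (E l))"
proof -
  have "\<forall>j\<in>{..D}. \<exists>c. dmat j = (\<Sum>l\<le>D. matrix_scale (c l) (E l))"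
    using dmat_span_E by (metis atMost_iff)
  then obtain c where c: "\<And>j. j \<le> D \<Longrightarrow> dmat j = (\<Sum>l\<le>D. matrix_scale (c j l) (E l))"
    unfolding bchoice_iff by auto
  have "M $ y $ z = (\<Sum>l\<le>D. matrix_scale (\<Sum>j\<le>D. f j * c j l) (E l)) $ y $ z" for y z
  proof -
    have "M $ y $ z = (\<Sum>j\<le>D. f j * dmat j $ y $ z)"
      by (simp add: f dmat_def sum_dist_delta)
    also have "\<dots> = (\<Sum>j\<le>D. \<Sum>l\<le>D. f j * (c j l * E l $ y $ z))"
      by (simp add: c matrix_scale_def sum_distrib_left)
    also have "\<dots> = (\<Sum>l\<le>D. matrix_scale (\<Sum>j\<le>D. f j * c j l) (E l)) $ y $ z"
      by (subst sum.swap) (simp add: matrix_scale_def sum_distrib_right mult.assoc)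
    finally show ?thesis .
  qed
  then have "M = (\<Sum>l\<le>D. matrix_scale (\<Sum>j\<le>D. f j * c j l) (E l))"
    unfolding vec_eq_iff by blast
  then show ?thesis by (rule that)
qed

text \<open>Justifies the choice in \<open>krein\<close>: an entrywise product again depends only on
  distance, so it has an expansion in the \<open>E l\<close>.\<close>

lemma hadamard_krein:
  assumes "i \<le> D" "j \<le> D"
  shows "hadamard (E i) (E j) =
    matrix_scale (1 / of_nat CARD('v)) (\<Sum>l\<le>D. matrix_scale (krein D E l i j) (E l))"
proof -
  obtain f g where fg: "\<And>y z. E i $ y $ z = of_real (f (dist y z))" "\<And>y z. E j $ y $ z = of_real (g (dist y z))"
    using E_entries assms by metis
  obtain c where c: "matrix_scale (of_nat CARD('v)) (hadamard (E i) (E j)) = (\<Sum>l\<le>D. matrix_scale (c l) (E l))"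
    by (rule distance_matrix_span_E[where M = "matrix_scale (of_nat CARD('v)) (hadamard (E i) (E j))"
          and f = "\<lambda>d. of_nat CARD('v) * (of_real (f d) * of_real (g d))"])
      (simp_all add: matrix_scale_def hadamard_def fg)
  have "\<exists>q. hadamard (E i) (E j) = matrix_scale (1 / of_nat CARD('v)) (\<Sum>l\<le>D. matrix_scale (q l) (E l))"
    by (rule exI[of _ c], unfold c[symmetric]) (simp add: matrix_scale_def vec_eq_iff)
  from someI_ex[OF this] show ?thesis
    unfolding krein_def .
qed

section \<open>Dual distance matrices and the dual triple relations\<close>

definition ddmat :: "nat \<Rightarrow> complex^'v^'v" where
  "ddmat k = (\<chi> y z. if y = z then of_nat CARD('v) * E k $ x $ y else 0)"

abbreviation As :: "complex^'v^'v" where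
  "As \<equiv> dual_adjacency_matrix E x"

lemma As_eq_ddmat: "As = ddmat 1"
  by (simp add: dual_adjacency_matrix_def ddmat_def del: One_nat_def)

lemma ddmat_mult_entry: "(ddmat k ** M) $ y $ z = of_nat CARD('v) * E k $ x $ y * M $ y $ z"
  by (simp add: ddmat_def matrix_matrix_mult_def if_distrib[of "\<lambda>t. t * _"] cong: if_cong)

lemma ddmat_vec_entry: "(ddmat k *v v) $ y = of_nat CARD('v) * E k $ x $ y * v $ y"
  by (simp add: ddmat_def matrix_vector_mult_def if_distrib[of "\<lambda>t. t * _"] cong: if_cong)

text \<open>Multiplying these diagonal matrices amounts to multiplying row \<open>x\<close> of the
  idempotents entrywise, so the Krein expansion becomes the recurrence.\<close>

sublocale ddmat: three_term_recurrence D As ddmat "\<lambda>h j. krein D E h 1 j"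
proof
  fix h j :: nat
  show "As ** ddmat j = (\<Sum>h\<le>D. matrix_scale (krein D E h 1 j) (ddmat h))" if j: "j \<le> D"
  proof -
    let ?n = "of_nat CARD('v) :: complex"
    have "?n * E 1 $ x $ y * (?n * E j $ x $ y) = (\<Sum>h\<le>D. krein D E h 1 j * (?n * E h $ x $ y))" for y
    proof -
      have "?n * E 1 $ x $ y * (?n * E j $ x $ y) = ?n * ?n * hadamard (E 1) (E j) $ x $ y"
        by (simp add: hadamard_def)
      also have "\<dots> = ?n * (\<Sum>h\<le>D. krein D E h 1 j * E h $ x $ y)"
        unfolding hadamard_krein[OF D_ge_1 j] by (simp add: matrix_scale_def)
      finally show ?thesis by (simp add: sum_distrib_left mult_ac)
    qed
    then show ?thesis
      by (simp add: vec_eq_iff As_eq_ddmat ddmat_mult_entry del: One_nat_def)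
        (simp add: ddmat_def matrix_scale_def del: One_nat_def)
  qed
  show "krein D E h 1 j = 0" if "h \<le> D" "j \<le> D" "h > Suc j \<or> j > Suc h"
    using Q_poly D_ge_1 that by (auto simp: Q_polynomial_def)
  assume "j < D"
  then have j: "Suc j \<le> D" "j \<le> D" by auto
  show "krein D E (Suc j) 1 j \<noteq> 0" "krein D E j 1 (Suc j) \<noteq> 0"
    using Q_poly[unfolded Q_polynomial_def, rule_format, of "Suc j" 1 j] j D_ge_1
      Q_poly[unfolded Q_polynomial_def, rule_format, of j 1 "Suc j"] by auto
next
  show "ddmat 0 = mat 1"
    by (simp add: vec_eq_iff ddmat_def mat_def E_0 matrix_scale_def)
qed

text \<open>The squared Frobenius norm of $E_h A^*_k E_j$ is $|X| q^k_{h,j} (E_k)_{x,x}$.\<close>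

lemma E_ddmat_E_eq_zero:
  assumes hjk: "h \<le> D" "j \<le> D" "k \<le> D" and q: "krein D E k h j = 0"
  shows "E h *v (ddmat k *v (E j *v v)) = 0"
proof -
  let ?n = "of_nat CARD('v) :: complex"
  let ?N = "E h ** ddmat k ** E j"
  have T: "transpose (E i) = E i" if "i \<le> D" for i
    using E_sym[OF that] by (simp add: vec_eq_iff transpose_def)
  have Td: "transpose (ddmat k) = ddmat k"
    by (auto simp: vec_eq_iff transpose_def ddmat_def)
  have idem: "E i ** E i = E i" if "i \<le> D" for i
    using E_mult_E[OF that that] by simp
  have NT: "transpose ?N = E j ** ddmat k ** E h"
    by (simp add: matrix_transpose_mul T Td hjk matrix_mul_assoc)
  have "?N ** transpose ?N = E h ** (ddmat k ** (E j ** E j) ** ddmat k ** E h)"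
    unfolding NT by (simp add: matrix_mul_assoc)
  then have "trace (?N ** transpose ?N) = trace (ddmat k ** E j ** ddmat k ** E h ** E h)"
    by (simp add: trace_mul_sym[of "E h"] idem hjk)
  also have "ddmat k ** E j ** ddmat k ** E h ** E h = (ddmat k ** E j) ** (ddmat k ** E h)"
    by (simp add: idem hjk flip: matrix_mul_assoc)
  also have "trace \<dots> = (\<Sum>y\<in>UNIV. \<Sum>w\<in>UNIV. ?n * E k $ x $ y * hadamard (E h) (E j) $ y $ w * (?n * E k $ w $ x))"
    unfolding trace_def matrix_matrix_mult_def[of "ddmat k ** E j"]
    by (simp add: ddmat_mult_entry hadamard_def E_sym[OF hjk(3), of _ x] E_sym[OF hjk(1)] mult_ac)
  also have "\<dots> = ?n * (\<Sum>l\<le>D. krein D E l h j * (E k ** E l ** E k) $ x $ x)"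
  proof -
    let ?g = "\<lambda>l y w. ?n * (krein D E l h j * (E k $ x $ y * E l $ y $ w * E k $ w $ x))"
    have "?n * E k $ x $ y * hadamard (E h) (E j) $ y $ w * (?n * E k $ w $ x) = (\<Sum>l\<le>D. ?g l y w)" for y w
      unfolding hadamard_krein[OF hjk(1,2)]
      by (simp add: matrix_scale_def sum_distrib_left sum_distrib_right mult_ac)
    then have "(\<Sum>y\<in>UNIV. \<Sum>w\<in>UNIV. ?n * E k $ x $ y * hadamard (E h) (E j) $ y $ w * (?n * E k $ w $ x))
        = (\<Sum>y\<in>UNIV. \<Sum>w\<in>UNIV. \<Sum>l\<le>D. ?g l y w)"
      by simp
    also have "\<dots> = (\<Sum>y\<in>UNIV. \<Sum>l\<le>D. \<Sum>w\<in>UNIV. ?g l y w)"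
      by (intro sum.cong refl sum.swap)
    also have "\<dots> = (\<Sum>l\<le>D. \<Sum>y\<in>UNIV. \<Sum>w\<in>UNIV. ?g l y w)"
      by (rule sum.swap)
    also have "\<dots> = (\<Sum>l\<le>D. ?n * (krein D E l h j * (E k ** E l ** E k) $ x $ x))"
    proof (intro sum.cong refl)
      fix l
      have "(E k ** E l ** E k) $ x $ x = (\<Sum>w\<in>UNIV. \<Sum>y\<in>UNIV. E k $ x $ y * E l $ y $ w * E k $ w $ x)"
        by (simp add: matrix_matrix_mult_def sum_distrib_right)
      also have "\<dots> = (\<Sum>y\<in>UNIV. \<Sum>w\<in>UNIV. E k $ x $ y * E l $ y $ w * E k $ w $ x)"
        by (rule sum.swap)
      finally show "(\<Sum>y\<in>UNIV. \<Sum>w\<in>UNIV. ?g l y w) = ?n * (krein D E l h j * (E k ** E l ** E k) $ x $ x)"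
        by (simp add: sum_distrib_left)
    qed
    finally show ?thesis by (simp add: sum_distrib_left)
  qed
  \<comment> \<open>\<open>E k ** E l ** E k\<close> is zero unless \<open>l = k\<close>, and there
    the coefficient is zero by \<open>q\<close>.\<close>
  also have "\<dots> = 0"
    using q by (simp add: E_mult_E hjk sum.neutral)
  finally have tr: "trace (?N ** transpose ?N) = 0" .
  \<comment> \<open>The transpose involves no conjugation, so real entries are what makes the trace
    a sum of nonnegative squares.\<close>
  have real: "?N $ y $ z \<in> \<real>" for y z
    unfolding matrix_matrix_mult_def using hjk by (auto intro!: sum_in_Reals Reals_mult E_real simp: ddmat_def)
  have "trace (?N ** transpose ?N) = of_real (\<Sum>y\<in>UNIV. \<Sum>z\<in>UNIV. (Re (?N $ y $ z))\<^sup>2)"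
  proof -
    have "?N $ y $ z * ?N $ y $ z = of_real ((Re (?N $ y $ z))\<^sup>2)" for y z
      using real[of y z] by (metis of_real_Re of_real_mult power2_eq_square)
    then show ?thesis
      unfolding trace_def matrix_matrix_mult_def[of ?N] by (simp add: transpose_def)
  qed
  with tr have "(\<Sum>y\<in>UNIV. \<Sum>z\<in>UNIV. (Re (?N $ y $ z))\<^sup>2) = 0"
    using of_real_eq_0_iff by metis
  then have "Re (?N $ y $ z) = 0" for y z
    by (simp add: sum_nonneg_eq_0_iff sum_nonneg)
  then have "?N = 0"
    using real by (simp add: vec_eq_iff complex_eq_iff complex_is_Real_iff)
  then show ?thesis
    by (simp add: matrix_vector_mul_assoc matrix_mul_assoc)
qed

abbreviation Es :: "nat \<Rightarrow> complex^'v^'v" where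
  "Es \<equiv> dual_idempotent adj x"

lemma Es_vec_entry: "(Es i *v v) $ y = (if dist x y = i then v $ y else 0)"
  by (simp add: dual_idempotent_def matrix_vector_mult_def if_distrib[of "\<lambda>t. t * _"] cong: if_cong)

lemma Es_dmat_Es_eq_zero:
  assumes "h > k + j \<or> j > k + h \<or> k > h + j"
  shows "Es h *v (dmat k *v (Es j *v v)) = 0"
proof -
  have "dmat k $ y $ z * (Es j *v v) $ z = 0" if "dist x y = h" for y z
    using assms that dist_triangle[of x y z] dist_triangle[of x z y] dist_triangle[of y z x]
      dist_sym[of z y] dist_sym[of y x]
    by (auto simp: Es_vec_entry dmat_def)
  then have "(dmat k *v (Es j *v v)) $ y = 0" if "dist x y = h" for y
    unfolding matrix_vector_mult_def[of "dmat k"] using that by (simp add: sum.neutral)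
  then show ?thesis
    by (simp add: vec_eq_iff Es_vec_entry[of h])
qed

text \<open>The dual eigenvalue; any vertex at distance \<open>d\<close> from \<open>x\<close> gives
  the same entry.\<close>

definition \<theta>s :: "nat \<Rightarrow> real" where
  "\<theta>s d = of_nat CARD('v) * Re (E 1 $ x $ (SOME y. dist x y = d))"

lemma As_entry: "of_nat CARD('v) * E 1 $ x $ y = of_real (\<theta>s (dist x y))"
proof -
  obtain f where f: "\<And>y z. E 1 $ y $ z = of_real (f (dist y z))"
    using E_entries[OF D_ge_1] by blast
  have "dist x (SOME z. dist x z = dist x y) = dist x y"
    by (rule someI) simp
  then show ?thesis
    by (simp add: \<theta>s_def f del: One_nat_def)
qed

text \<open>If two distances shared a dual eigenvalue, \<open>As\<close> and with it every
  \<open>ddmat k\<close> would act by one scalar on the unit vectors of two vertices at these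
  distances. Then all \<open>E k\<close> agree at both in row \<open>x\<close>, and so does
  \<open>dmat a\<close>, which tells the distances apart.\<close>

lemma inj_\<theta>s: "inj_on \<theta>s {..D}"
proof (rule inj_onI)
  fix a b assume ab: "a \<in> {..D}" "b \<in> {..D}" "\<theta>s a = \<theta>s b"
  obtain y z where yz: "dist x y = a" "dist x z = b"
    using ab dist_attained_from by (metis atMost_iff)
  have axis: "(ddmat k *v axis w 1) $ w = of_nat CARD('v) * E k $ x $ w" for k w
    by (simp add: ddmat_vec_entry axis_def)
  have eq: "E k $ x $ y = E k $ x $ z" if k: "k \<le> D" for k
  proof -
    have "As *v axis w 1 = of_real (\<theta>s (dist x w)) *s axis w 1" for w
      by (simp add: vec_eq_iff As_eq_ddmat ddmat_vec_entry As_entry axis_def del: One_nat_def)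
    then have "As \<in> {M. \<exists>c. \<forall>v\<in>{axis y 1, axis z 1}. M *v v = c *s v}"
      using ab yz by auto
    then obtain c where "ddmat k *v axis y 1 = c *s axis y 1" "ddmat k *v axis z 1 = c *s axis z 1"
      using ddmat.mem_subalgebra[OF matrix_subalgebra_scalar_on _ k] by blast
    then have "of_nat CARD('v) * E k $ x $ y = c" "of_nat CARD('v) * E k $ x $ z = c"
      by (simp_all add: axis_def flip: axis)
    then have "of_nat CARD('v) * E k $ x $ y = of_nat CARD('v) * E k $ x $ z"
      by simp
    then show ?thesis by simp
  qed
  obtain c where c: "dmat a = (\<Sum>l\<le>D. matrix_scale (c l) (E l))"
    using dmat_span_E[of a] ab by auto
  have "dmat a $ x $ y = dmat a $ x $ z"
    unfolding c by (simp add: matrix_scale_def eq)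
  then show "a = b"
    using yz by (auto simp: dmat_def split: if_splits)
qed

lemma selfadjoint_As: "selfadjoint As"
  by (rule selfadjoint_real_symmetric[where m = "\<lambda>y z. if y = z then \<theta>s (dist x y) else 0"])
    (auto simp: dual_adjacency_matrix_def As_entry simp del: One_nat_def)

text \<open>\<open>dmat D\<close> is generated by \<open>A\<close> and serves the system of the
  \<open>Es\<close>; \<open>ddmat D\<close> is generated by \<open>As\<close> and serves that of the
  \<open>E\<close>. Their long-range vanishing comes from the triangle inequality and from the Krein
  condition, respectively.\<close>

sublocale subconstituent: tridiagonal_pair D A As "dmat D" "ddmat D" \<theta> \<theta>s E Es
proof
  fix v i h j
  show "(\<Sum>i\<le>D. E i *v v) = v" by (rule sum_E)
  show "E i *v (E j *v v) = (if i = j then E j *v v else 0)" if "i \<le> D" "j \<le> D"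
    using E_E that .
  show "A *v (E i *v v) = of_real (\<theta> i) *s (E i *v v)" if "i \<le> D"
    using E_eigenspace[OF that] by (simp add: eigenspace_def)
  show "inj_on \<theta> {..D}" by (rule inj_\<theta>)
  have krein: "krein D E k h j = 0"
    if "h \<le> D" "j \<le> D" "k \<le> D" "h > k + j \<or> j > k + h \<or> k > h + j" for k
    using Q_poly that by (auto simp: Q_polynomial_def)
  show "E h *v (As *v (E j *v v)) = 0" if "h \<le> D" "j \<le> D" "h > Suc j \<or> j > Suc h"
    unfolding As_eq_ddmat using that D_ge_1 by (intro E_ddmat_E_eq_zero krein) auto
  show "E h *v (ddmat D *v (E j *v v)) = 0" if "h \<le> D" "j \<le> D" "h + j < D"
    using that by (intro E_ddmat_E_eq_zero krein) auto
  show "v = 0" if "ddmat D *v v = 0"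
    using that by (rule ddmat.injective_M)
  show "v = 0" if "dmat D *v v = 0"
    using that by (rule dmat.injective_M)
  show "invariant (ddmat D) W" if "vec.subspace W" "invariant As W" for W
    using ddmat.mem_subalgebra[OF matrix_subalgebra_invariant[OF that(1)] _ order_refl] that by simp
  show "invariant (dmat D) W" if "vec.subspace W" "invariant A W" for W
    using dmat.mem_subalgebra[OF matrix_subalgebra_invariant[OF that(1)] _ order_refl] that by simp
  show "(\<Sum>i\<le>D. Es i *v v) = v"
    using dist_le_D by (simp add: vec_eq_iff Es_vec_entry)
  show "Es i *v (Es j *v v) = (if i = j then Es j *v v else 0)"
    by (simp add: vec_eq_iff Es_vec_entry)
  show "As *v (Es i *v v) = of_real (\<theta>s i) *s (Es i *v v)"
    by (simp add: vec_eq_iff As_eq_ddmat ddmat_vec_entry As_entry Es_vec_entry del: One_nat_def)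
  show "inj_on \<theta>s {..D}" by (rule inj_\<theta>s)
  show "Es h *v (A *v (Es j *v v)) = 0" if "h > Suc j \<or> j > Suc h"
    unfolding A_eq_dmat using that by (intro Es_dmat_Es_eq_zero) auto
  show "Es h *v (dmat D *v (Es j *v v)) = 0" if "h + j < D"
    using that by (intro Es_dmat_Es_eq_zero) auto
  show "selfadjoint A" "selfadjoint As"
    by (rule selfadjoint_A selfadjoint_As)+
qed

lemma displacement_eq:
  assumes "irreducible_pair_module A As W"
  shows "displacement adj E x W =
    int (Max (module_support D Es W) + Min (module_support D E W)) - int D"
  using subconstituent.irreducible_Min_plus_diameter[OF assms]
  by (simp add: displacement_def endpoint_def dual_endpoint_def module_diameter_def flip: D_def)

theorem sum_nucleus_part: "(\<Sum>i\<le>D. nucleus_part adj E x i) = nucleus adj E x"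
proof -
  have "(\<Sum>i\<le>D. nucleus_part adj E x i) = (\<Sum>i\<le>D. subconstituent.layer D UNIV i)"
    by (intro sum.cong refl)
      (simp add: nucleus_part_def subconstituent.layer_UNIV_eq flip: D_def)
  also have "\<dots> = vec.span (\<Union>{W. irreducible_pair_module A As W \<and>
      Max (module_support D Es W) + Min (module_support D E W) = D})"
    by (simp only: subconstituent.sum_layer_UNIV subconstituent.layer_span_eq_span_irreducible)
  also have "{W. irreducible_pair_module A As W \<and>
      Max (module_support D Es W) + Min (module_support D E W) = D} =
      {W. irreducible_matrix_module (T_algebra adj E x) W \<and> displacement adj E x W = 0}"
    unfolding T_algebra_def irreducible_matrix_module_generated
    by (intro Collect_cong conj_cong refl) (auto simp: displacement_eq simp flip: of_nat_add)
  finally show ?thesis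
    by (simp add: nucleus_def)
qed

end

theorem theorem7p5:
  fixes adj :: "'v::finite \<Rightarrow> 'v \<Rightarrow> bool"
    and E :: "nat \<Rightarrow> complex^'v^'v"
    and x :: 'v
    and D :: nat
  assumes "D = graph_diameter adj"
    and "D \<ge> 1"
    and "distance_regular adj"
    and "idempotent_ordering adj E"
    and "Q_polynomial D E"
  shows "(\<Sum>i\<le>D. nucleus_part adj E x i) = nucleus adj E x"
proof -
  interpret distance_regular_graph adj D
    using assms by unfold_locales
  have "bij_betw E {..D} {F. primitive_idempotent (adjacency_matrix adj) F}"
    using assms by (simp add: idempotent_ordering_def)
  \<comment> \<open>The ordering names no eigenvalues; they are recovered from the idempotents
    here.\<close>
  then obtain \<theta> where \<theta>: "inj_on \<theta> {..D}"
    "\<And>i v. i \<le> D \<Longrightarrow> E i *v v \<in> eigenspace (adjacency_matrix adj) (of_real (\<theta> i))"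
    "\<And>i j v. i \<le> D \<Longrightarrow> j \<le> D \<Longrightarrow> E i *v (E j *v v) = (if i = j then E j *v v else 0)"
    "\<And>v. (\<Sum>i\<le>D. E i *v v) = v"
    by (rule primitive_idempotents_eigenvalues[OF selfadjoint_A]) (rule that; assumption)
  interpret Q_polynomial_graph adj D E \<theta> x
    using assms \<theta> by unfold_locales (auto simp: idempotent_ordering_def)
  show ?thesis by (rule sum_nucleus_part)
qed

end
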